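(* Let $M$ be an $\mathfrak{S}^{\frac12}$-module such that the restriction of $M$ to a $U(\mathfrak{T})$-module is free of rank $2$, where $\mathfrak{T}=\mathbb{C}L_0\oplus\mathbb{C}W_0$. Then, up to a parity-change (that is, for $M$ or for $\Pi(M)$), we have $M\cong\Omega_{\mathfrak{S}^{\frac12}}(\lambda,\alpha,h)$ for some $\lambda\in\mathbb{C}^*$, $\alpha\in\mathbb{C}$, $h(t)\in\mathbb{C}[t]$.
   Context: All vector spaces are over $\mathbb{C}$. The Neveu-Schwarz type super-BMS$_3$ algebra $\mathfrak{S}^{\frac12}$ is the Lie superalgebra with basis $\{L_m,W_m,G_r,C_1,C_2\mid m\in\mathbb{Z},r\in\frac12+\mathbb{Z}\}$, where $L_m,W_m,C_1,C_2$ are even, the $G_r$ are odd, $C_1,C_2$ are central, and the non-trivial brackets are $$[L_m,L_n]=(n-m)L_{m+n}+\tfrac{n^3-n}{12}\delta_{m+n,0}C_1,\quad [L_m,W_n]=(n-m)W_{m+n}+\tfrac{n^3-n}{12}\delta_{m+n,0}C_2,$$ $$[L_m,G_r]=(r-\tfrac m2)G_{m+r},\quad [G_r,G_s]=2W_{r+s}+\tfrac13(r^2-\tfrac14)\delta_{r+s,0}C_2.$$ Modules over a Lie superalgebra are $\mathbb{Z}_2$-graded, with $x(yv)-(-1)^{|x||y|}y(xv)=[x,y]v$ for homogeneous $x,y$. $\Pi$ is the parity-change functor, interchanging the even and odd parts of a module. $U(\mathfrak{T})=\mathbb{C}[L_0,W_0]$, and free of rank $2$ over $U(\mathfrak{T})$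 means free with a basis of two homogeneous elements. For a polynomial $h$, $\alpha\in\mathbb{C}$ and $m\in\mathbb{Z}$, $h_m(t)=m\,h(t)-m(m-1)\alpha\,\frac{h(t)-h(\alpha)}{t-\alpha}\in\mathbb{C}[t]$. For $\lambda\in\mathbb{C}^*$, $\alpha\in\mathbb{C}$, $h\in\mathbb{C}[t]$, $\Omega_{\mathfrak{S}^{\frac12}}(\lambda,\alpha,h)$ is the $\mathfrak{S}^{\frac12}$-module with underlying space $\mathbb{C}[t,s]\oplus\mathbb{C}[y,x]$, even part $\mathbb{C}[t,s]$, odd part $\mathbb{C}[y,x]$, and action (for $m\in\mathbb{Z}$, $r\in\frac12+\mathbb{Z}$, $f(t,s)\in\mathbb{C}[t,s]$, $k(y,x)\in\mathbb{C}[y,x]$) $$L_mf(t,s)=\lambda^m(s+h_m(t))f(t,s-m)-m\lambda^m(t-m\alpha)\tfrac{\partial}{\partial t}(f(t,s-m)),$$ $$L_mk(y,x)=\lambda^m(x-\tfrac m2+h_m(y))k(y,x-m)-m\lambda^m(y-m\alpha)\tfrac{\partial}{\partial y}k(y,x-m),$$ $$W_mf(t,s)=\lambda^m(t-m\alpha)f(t,s-m),\quad W_mk(y,x)=\lambda^m(y-m\alpha)k(y,x-m),$$ $$G_rf(t,s)=\lambda^{r-\frac12}f(y,x-r)\in\mathbb{C}[y,x],\quad G_rk(y,x)=\lambda^{r+\frac12}(t-2r\alpha)k(t,s-r)\in\mathbb{C}[t,s],$$ with $C_1,C_2$ acting as $0$. *)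

theory Defs
  imports
    Complex_Main
    "HOL-Computational_Algebra.Polynomial"
    "HOL-Library.Poly_Mapping"
    "HOL-Library.Product_Plus"
    "HOL-Library.Z2"
begin

text \<open>The type \<open>bit\<close> is \<open>\<int>/2\<int>\<close>: \<open>hpart 0\<close> is the even part, \<open>hpart 1\<close> the odd part.\<close>

locale super_vector_space = vector_space scale
  for scale :: "complex \<Rightarrow> 'a::ab_group_add \<Rightarrow> 'a" +
  fixes hpart :: "bit \<Rightarrow> 'a set"
  assumes subspace_part: "subspace (hpart i)"
    and part_Int: "hpart 0 \<inter> hpart 1 = {0}"
    and part_sum: "\<exists>a\<in>hpart 0. \<exists>b\<in>hpart 1. v = a + b"

definition koszul_sign :: "bit \<Rightarrow> bit \<Rightarrow> complex" where
  "koszul_sign i j = (if i = 1 \<and> j = 1 then -1 else 1)"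

locale lie_superalgebra = super_vector_space gscale gpart
  for gscale :: "complex \<Rightarrow> 'g::ab_group_add \<Rightarrow> 'g" and gpart :: "bit \<Rightarrow> 'g set" +
  fixes bracket :: "'g \<Rightarrow> 'g \<Rightarrow> 'g"
  assumes bracket_linear_left: "Vector_Spaces.linear gscale gscale (\<lambda>x. bracket x y)"
    and bracket_linear_right: "Vector_Spaces.linear gscale gscale (\<lambda>y. bracket x y)"
    and bracket_part: "x \<in> gpart i \<Longrightarrow> y \<in> gpart j \<Longrightarrow> bracket x y \<in> gpart (i + j)"
    and bracket_skew: "x \<in> gpart i \<Longrightarrow> y \<in> gpart j \<Longrightarrow>
          bracket x y = - gscale (koszul_sign i j) (bracket y x)"
    and bracket_jacobi: "x \<in> gpart i \<Longrightarrow> y \<in> gpart j \<Longrightarrow>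
          bracket x (bracket y z) =
            bracket (bracket x y) z + gscale (koszul_sign i j) (bracket y (bracket x z))"

locale lie_supermodule =
  lie_superalgebra gscale gpart bracket + M: super_vector_space scale hpart
  for gscale :: "complex \<Rightarrow> 'g::ab_group_add \<Rightarrow> 'g" and gpart bracket
    and scale :: "complex \<Rightarrow> 'm::ab_group_add \<Rightarrow> 'm" and hpart +
  fixes act :: "'g \<Rightarrow> 'm \<Rightarrow> 'm"
  assumes act_linear_left: "Vector_Spaces.linear gscale scale (\<lambda>x. act x v)"
    and act_linear_right: "Vector_Spaces.linear scale scale (act x)"
    and act_part: "x \<in> gpart i \<Longrightarrow> v \<in> hpart j \<Longrightarrow> act x v \<in> hpart (i + j)"
    and act_bracket: "x \<in> gpart i \<Longrightarrow> y \<in> gpart j \<Longrightarrow>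
          act (bracket x y) v = act x (act y v) - scale (koszul_sign i j) (act y (act x v))"

text \<open>The functor \<open>\<Pi>\<close> keeps the space and the action and shifts the grading.\<close>

definition parity_change :: "(bit \<Rightarrow> 'm set) \<Rightarrow> bit \<Rightarrow> 'm set" where
  "parity_change hpart i = hpart (i + 1)"

definition supermodule_iso ::
  "(complex \<Rightarrow> 'm::ab_group_add \<Rightarrow> 'm) \<Rightarrow> (bit \<Rightarrow> 'm set) \<Rightarrow> ('g \<Rightarrow> 'm \<Rightarrow> 'm) \<Rightarrow>
   (complex \<Rightarrow> 'n::ab_group_add \<Rightarrow> 'n) \<Rightarrow> (bit \<Rightarrow> 'n set) \<Rightarrow> ('g \<Rightarrow> 'n \<Rightarrow> 'n) \<Rightarrow> bool" where
  "supermodule_iso scale hpart act scale' hpart' act' \<longleftrightarrow>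
     (\<exists>\<phi>. Vector_Spaces.linear scale scale' \<phi> \<and> bij \<phi> \<and> (\<forall>i. \<phi> ` hpart i = hpart' i) \<and>
          (\<forall>x v. \<phi> (act x v) = act' x (\<phi> v)))"

text \<open>\<open>G k\<close> stands for \<open>G\<^sub>r\<close> with \<open>r = k + 1/2\<close>.\<close>

datatype ns_basis = L int | W int | G int | C1 | C2

definition half :: "int \<Rightarrow> complex" where
  "half k = of_int k + 1/2"

type_synonym ns_alg = "ns_basis \<Rightarrow>\<^sub>0 complex"

abbreviation unit_vec :: "ns_basis \<Rightarrow> ns_alg" where
  "unit_vec b \<equiv> Poly_Mapping.single b 1"

definition ns_scale :: "complex \<Rightarrow> ns_alg \<Rightarrow> ns_alg" where
  "ns_scale c x = Poly_Mapping.map ((*) c) x"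

definition lin_ext :: "(complex \<Rightarrow> 'm::ab_group_add \<Rightarrow> 'm) \<Rightarrow> (ns_basis \<Rightarrow> 'm) \<Rightarrow> ns_alg \<Rightarrow> 'm" where
  "lin_ext scale f x = (\<Sum>b\<in>Poly_Mapping.keys x. scale (Poly_Mapping.lookup x b) (f b))"

fun ns_parity :: "ns_basis \<Rightarrow> bit" where
  "ns_parity (G k) = 1"
| "ns_parity _ = 0"

definition ns_part :: "bit \<Rightarrow> ns_alg set" where
  "ns_part i = {x. \<forall>b\<in>Poly_Mapping.keys x. ns_parity b = i}"

definition cocycle :: "int \<Rightarrow> int \<Rightarrow> complex" where
  "cocycle m n = (if m + n = 0 then (of_int n ^ 3 - of_int n) / 12 else 0)"

text \<open>The half-integers \<open>j + 1/2\<close> and \<open>k + 1/2\<close> sum to \<open>j + k + 1\<close>.\<close>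

fun ns_br :: "ns_basis \<Rightarrow> ns_basis \<Rightarrow> ns_alg" where
  "ns_br (L m) (L n) = ns_scale (of_int (n - m)) (unit_vec (L (m + n))) + ns_scale (cocycle m n) (unit_vec C1)"
| "ns_br (L m) (W n) = ns_scale (of_int (n - m)) (unit_vec (W (m + n))) + ns_scale (cocycle m n) (unit_vec C2)"
| "ns_br (W n) (L m) = - (ns_scale (of_int (n - m)) (unit_vec (W (m + n))) + ns_scale (cocycle m n) (unit_vec C2))"
| "ns_br (L m) (G k) = ns_scale (half k - of_int m / 2) (unit_vec (G (m + k)))"
| "ns_br (G k) (L m) = - ns_scale (half k - of_int m / 2) (unit_vec (G (m + k)))"
| "ns_br (G j) (G k) = ns_scale 2 (unit_vec (W (j + k + 1))) +
     ns_scale (if j + k + 1 = 0 then (half j ^ 2 - 1/4) / 3 else 0) (unit_vec C2)"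
| "ns_br _ _ = 0"

definition ns_bracket :: "ns_alg \<Rightarrow> ns_alg \<Rightarrow> ns_alg" where
  "ns_bracket x y = lin_ext ns_scale (\<lambda>a. lin_ext ns_scale (ns_br a) y) x"

abbreviation ns_module ::
  "(complex \<Rightarrow> 'm::ab_group_add \<Rightarrow> 'm) \<Rightarrow> (bit \<Rightarrow> 'm set) \<Rightarrow> (ns_alg \<Rightarrow> 'm \<Rightarrow> 'm) \<Rightarrow> bool" where
  "ns_module \<equiv> lie_supermodule ns_scale ns_part ns_bracket"

text \<open>
  For \<open>U(\<TT>) = \<complex>[L\<^sub>0, W\<^sub>0]\<close>: a polynomial in two variables is an element of \<open>\<complex>[t][s]\<close>: the variable \<open>s\<close> of the outer
  polynomial stands for \<open>L\<^sub>0\<close>, the variable \<open>t\<close> of its coefficients for \<open>W\<^sub>0\<close>.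
\<close>

definition UT_scale ::
  "(complex \<Rightarrow> 'm::ab_group_add \<Rightarrow> 'm) \<Rightarrow> (ns_alg \<Rightarrow> 'm \<Rightarrow> 'm) \<Rightarrow> complex poly poly \<Rightarrow> 'm \<Rightarrow> 'm" where
  "UT_scale scale act p v =
     (\<Sum>i\<le>degree p. \<Sum>j\<le>degree (coeff p i).
        scale (coeff (coeff p i) j) ((act (unit_vec (L 0)) ^^ i) ((act (unit_vec (W 0)) ^^ j) v)))"

definition UT_free_rank2 ::
  "(complex \<Rightarrow> 'm::ab_group_add \<Rightarrow> 'm) \<Rightarrow> (bit \<Rightarrow> 'm set) \<Rightarrow> (ns_alg \<Rightarrow> 'm \<Rightarrow> 'm) \<Rightarrow> bool" where
  "UT_free_rank2 scale hpart act \<longleftrightarrow>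
     (\<exists>B. B \<subseteq> hpart 0 \<union> hpart 1 \<and> card B = 2 \<and>
          \<not> module.dependent (UT_scale scale act) B \<and> module.span (UT_scale scale act) B = UNIV)"

text \<open>The division by \<open>t - \<alpha>\<close> is exact.\<close>

definition hm :: "complex poly \<Rightarrow> complex \<Rightarrow> int \<Rightarrow> complex poly" where
  "hm h \<alpha> m = smult (of_int m) h -
     smult (of_int (m * (m - 1)) * \<alpha>) ((h - [:poly h \<alpha>:]) div [:- \<alpha>, 1:])"

text \<open>
  Both \<open>\<complex>[t,s]\<close> and \<open>\<complex>[y,x]\<close> are represented by \<open>complex poly poly\<close>, with \<open>s\<close> resp. \<open>x\<close>
  the outer variable and \<open>t\<close> resp. \<open>y\<close> the inner one.
\<close>

abbreviation inner_var :: "complex poly poly" where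
  "inner_var \<equiv> [:[:0, 1:]:]"

abbreviation outer_var :: "complex poly poly" where
  "outer_var \<equiv> [:0, 1:]"

abbreviation const :: "complex \<Rightarrow> complex poly poly" where
  "const c \<equiv> [:[:c:]:]"

text \<open>\<open>shift c f\<close> is \<open>f(t, s - c)\<close>.\<close>

definition shift :: "complex \<Rightarrow> complex poly poly \<Rightarrow> complex poly poly" where
  "shift c f = pcompose f (outer_var - const c)"

definition d_inner :: "complex poly poly \<Rightarrow> complex poly poly" where
  "d_inner f = map_poly pderiv f"

type_synonym omega = "complex poly poly \<times> complex poly poly"

definition omega_scale :: "complex \<Rightarrow> omega \<Rightarrow> omega" where
  "omega_scale c v = (const c * fst v, const c * snd v)"

definition omega_part :: "bit \<Rightarrow> omega set" where
  "omega_part i = (if i = 0 then UNIV \<times> {0} else {0} \<times> UNIV)"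

text \<open>With \<open>r = k + 1/2\<close>, the scalars \<open>\<lambda>\<^bsup>r - 1/2\<^esup>\<close> and \<open>\<lambda>\<^bsup>r + 1/2\<^esup>\<close> are \<open>\<lambda>\<^bsup>k\<^esup>\<close> and \<open>\<lambda>\<^bsup>k + 1\<^esup>\<close>.\<close>

fun omega_gen :: "complex \<Rightarrow> complex \<Rightarrow> complex poly \<Rightarrow> ns_basis \<Rightarrow> omega \<Rightarrow> omega" where
  "omega_gen lam \<alpha> h (L m) (f, k) =
    (const (lam powi m) * (outer_var + [:hm h \<alpha> m:]) * shift (of_int m) f
       - const (of_int m * lam powi m) * (inner_var - const (of_int m * \<alpha>)) * d_inner (shift (of_int m) f),
     const (lam powi m) * (outer_var - const (of_int m / 2) + [:hm h \<alpha> m:]) * shift (of_int m) k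
       - const (of_int m * lam powi m) * (inner_var - const (of_int m * \<alpha>)) * d_inner (shift (of_int m) k))"
| "omega_gen lam \<alpha> h (W m) (f, k) =
    (const (lam powi m) * (inner_var - const (of_int m * \<alpha>)) * shift (of_int m) f,
     const (lam powi m) * (inner_var - const (of_int m * \<alpha>)) * shift (of_int m) k)"
| "omega_gen lam \<alpha> h (G j) (f, k) =
    (const (lam powi (j + 1)) * (inner_var - const (2 * half j * \<alpha>)) * shift (half j) k,
     const (lam powi j) * shift (half j) f)"
| "omega_gen lam \<alpha> h C1 (f, k) = (0, 0)"
| "omega_gen lam \<alpha> h C2 (f, k) = (0, 0)"

definition omega_act :: "complex \<Rightarrow> complex \<Rightarrow> complex poly \<Rightarrow> ns_alg \<Rightarrow> omega \<Rightarrow> omega" where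
  "omega_act lam \<alpha> h x v = lin_ext omega_scale (\<lambda>b. omega_gen lam \<alpha> h b v) x"

end

theory Submission
  imports Defs
begin

text \<open>
  Write \<open>t\<close> for \<open>W\<^sub>0\<close> and \<open>s\<close> for \<open>L\<^sub>0\<close>. The two homogeneous basis vectors must have different parity: otherwise
  every \<open>G\<^sub>r\<close> acts as zero, and then so does \<open>W\<^sub>0 = G\<^bsub>1/2\<^esub>G\<^bsub>-1/2\<^esub> / 2 + G\<^bsub>-1/2\<^esub>G\<^bsub>1/2\<^esub> / 2\<close>. Let \<open>v 0\<close> be the even and
  \<open>v 1\<close> the odd one. The brackets with \<open>L\<^sub>0\<close> and \<open>W\<^sub>0\<close> say that \<open>W\<^sub>m\<close> and \<open>G\<^sub>r\<close> move past polynomials by the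
  shifts \<open>s \<mapsto> s - m\<close> and \<open>s \<mapsto> s - r\<close>, and that \<open>L\<^sub>m\<close> does so up to a derivation along \<open>W\<^sub>m\<close>. So the action is
  known once the polynomials \<open>Wc\<close>, \<open>Lc\<close>, \<open>Gc\<close> with \<open>W\<^sub>m v\<^sub>i = Wc m i \<cdot> v\<^sub>i\<close>, \<open>L\<^sub>m v\<^sub>i = Lc m i \<cdot> v\<^sub>i\<close> and
  \<open>G\<^sub>r v\<^sub>i = Gc k i \<cdot> v\<^bsub>i+1\<^esub>\<close> (\<open>r = k + 1/2\<close>) are known, and every bracket becomes an equation between them.

  \<^bold>\<open>The scalars.\<close> The brackets of \<open>L\<^bsub>\<mp>1\<^esub>\<close> and \<open>W\<^bsub>\<plusminus>1\<^esub>\<close> give \<open>\<plusminus>2W\<^sub>0\<close>, so \<open>W\<^bsub>\<plusminus>1\<^esub>\<close> do not vanish. Since they commute, the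
  product of their coefficients with one argument shifted is periodic in \<open>s\<close>, hence free of \<open>s\<close>; every \<open>Wc m i\<close> then
  lies in \<open>\<complex>[t]\<close> (\<open>Wc_degree\<close>). As \<open>G\<^bsub>\<plusminus>1/2\<^esub>\<close> square to \<open>W\<^bsub>\<plusminus>1\<^esub>\<close>, their coefficients lie in \<open>\<complex>[t]\<close> too. The two cross
  products \<open>u\<close>, \<open>w\<close> of these coefficients satisfy \<open>u + w = 2t\<close> (anticommutator of \<open>G\<^bsub>1/2\<^esub>\<close> and \<open>G\<^bsub>-1/2\<^esub>\<close>) and
  \<open>(u w)' = 2t\<close> (commutator of \<open>L\<^sub>1\<close> and \<open>W\<^bsub>-1\<^esub>\<close>), which forces \<open>u = t - \<alpha>\<close> and \<open>w = t + \<alpha>\<close>. So each pair of factors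
  consists of a constant and a linear polynomial. The distributions of the linear factors in which one of \<open>W\<^bsub>\<plusminus>1\<^esub>\<close> is a constant
  and the other is quadratic are excluded by \<open>W\<^bsub>\<plusminus>2\<^esub>\<close>. Hence \<open>G\<^bsub>\<plusminus>1/2\<^esub>\<close> both map one of the two basis vectors to
  a nonzero constant multiple of the other (\<open>odd_operators_scalar\<close>). This is where the parity change enters, and the
  quotient of the two constants is \<open>\<lambda>\<close>.

  \<^bold>\<open>The rest of the action.\<close> After normalising \<open>v 1 = G\<^bsub>1/2\<^esub> v 0\<close>, the bracket with \<open>L\<^bsub>\<mp>1\<^esub>\<close> determines \<open>W\<^sub>m\<close> from
  \<open>W\<^bsub>m\<mp>1\<^esub>\<close>, because the operators \<open>p \<mapsto> n q' p + q p'\<close> are injective for nonconstant \<open>q\<close>: up to a power of \<open>q\<close>, they are the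
  derivative of \<open>q\<^sup>n p\<close> (\<open>euler_operator_injective\<close>). The bracket of \<open>L\<^sub>m\<close> with \<open>W\<^sub>1\<close> shows \<open>L\<^sub>m v\<^sub>i = \<lambda>\<^sup>m (s + H\<^sub>m) v\<^sub>i\<close> with
  \<open>H\<^sub>m \<in> \<complex>[t]\<close>, and the same injectivity determines all \<open>H\<^sub>m\<close> from \<open>h = H\<^sub>1\<close>. Writing \<open>h = c + (t - \<alpha>) q\<close> with
  \<open>c = h(\<alpha>)\<close>, the solution is \<open>H\<^sub>m = m (c + (t - m\<alpha>) q)\<close>, which is the polynomial \<open>h\<^sub>m\<close>; on the odd part it is lowered
  by \<open>m/2\<close>. The remaining \<open>G\<^sub>r\<close> and the central elements are brackets of operators that are then known.
\<close>

section \<open>Modules over a polynomial ring from a commuting endomorphism\<close>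

definition poly_act :: "('a::comm_ring_1 \<Rightarrow> 'm::ab_group_add \<Rightarrow> 'm) \<Rightarrow> ('m \<Rightarrow> 'm) \<Rightarrow> 'a poly \<Rightarrow> 'm \<Rightarrow> 'm" where
  "poly_act \<rho> T p v = (\<Sum>i\<le>degree p. \<rho> (coeff p i) ((T ^^ i) v))"

text \<open>
  A module over \<open>R\<close> with an \<open>R\<close>-linear endomorphism is a module over \<open>R[X]\<close>. Used twice, for \<open>W\<^sub>0\<close> over \<open>\<complex>\<close> and then for
  \<open>L\<^sub>0\<close> over \<open>\<complex>[t]\<close>, it turns the representation space into a module over \<open>\<complex>[t][s]\<close>.
\<close>

locale module_endo = module \<rho> for \<rho> :: "'a::comm_ring_1 \<Rightarrow> 'm::ab_group_add \<Rightarrow> 'm" +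
  fixes T :: "'m \<Rightarrow> 'm"
  assumes T_add: "T (x + y) = T x + T y"
    and T_scale: "T (\<rho> a x) = \<rho> a (T x)"
begin

lemma T_zero: "T 0 = 0"
  using T_add[of 0 0] by simp

lemma T_pow_add: "(T ^^ i) (x + y) = (T ^^ i) x + (T ^^ i) y"
  by (induction i) (simp_all add: T_add)

lemma T_sum: "T (sum f A) = (\<Sum>a\<in>A. T (f a))"
  by (induction A rule: infinite_finite_induct) (simp_all add: T_add T_zero)

text \<open>
  A summation range that does not depend on the polynomial, so that sums of polynomials of different degrees can be
  compared term by term.
\<close>

lemma poly_act_eq_sum:
  assumes "degree p \<le> n"
  shows "poly_act \<rho> T p v = (\<Sum>i\<le>n. \<rho> (coeff p i) ((T ^^ i) v))"
  unfolding poly_act_def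
  by (rule sum.mono_neutral_left) (use assms in \<open>auto simp: coeff_eq_0\<close>)

lemma poly_act_add_left: "poly_act \<rho> T (p + q) v = poly_act \<rho> T p v + poly_act \<rho> T q v"
proof -
  define n where "n = max (degree p) (degree q)"
  have "degree p \<le> n" "degree q \<le> n" "degree (p + q) \<le> n"
    by (auto simp: n_def intro: degree_add_le_max)
  then show ?thesis
    by (simp add: poly_act_eq_sum scale_left_distrib sum.distrib)
qed

lemma poly_act_add_right: "poly_act \<rho> T p (v + w) = poly_act \<rho> T p v + poly_act \<rho> T p w"
  by (simp add: poly_act_def T_pow_add scale_right_distrib sum.distrib)

lemma poly_act_0: "poly_act \<rho> T 0 v = 0"
  by (simp add: poly_act_def)

lemma poly_act_pCons: "poly_act \<rho> T (pCons a p) v = \<rho> a v + T (poly_act \<rho> T p v)"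
proof -
  have "degree (pCons a p) \<le> Suc (degree p)" by (simp add: degree_pCons_le)
  then have "poly_act \<rho> T (pCons a p) v = (\<Sum>i\<le>Suc (degree p). \<rho> (coeff (pCons a p) i) ((T ^^ i) v))"
    by (rule poly_act_eq_sum)
  also have "\<dots> = \<rho> a v + (\<Sum>i\<le>degree p. \<rho> (coeff p i) (T ((T ^^ i) v)))"
    by (subst sum.atMost_Suc_shift) simp
  also have "(\<Sum>i\<le>degree p. \<rho> (coeff p i) (T ((T ^^ i) v))) = T (poly_act \<rho> T p v)"
    by (simp add: poly_act_def T_sum T_scale)
  finally show ?thesis .
qed

lemma poly_act_const: "poly_act \<rho> T [:a:] v = \<rho> a v"
  by (simp add: poly_act_pCons poly_act_0 T_zero)

lemma poly_act_smult: "poly_act \<rho> T (smult a p) v = \<rho> a (poly_act \<rho> T p v)"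
  by (induction p) (simp_all add: poly_act_0 poly_act_pCons scale_right_distrib T_scale)

lemma poly_act_mult: "poly_act \<rho> T (p * q) v = poly_act \<rho> T p (poly_act \<rho> T q v)"
  by (induction p) (simp_all add: poly_act_0 poly_act_pCons poly_act_add_left poly_act_smult)

lemma module_poly_act: "module (poly_act \<rho> T)"
  by unfold_locales
     (simp_all add: poly_act_add_left poly_act_add_right poly_act_mult one_pCons poly_act_const
        flip: pCons_one)

lemma poly_act_commute:
  assumes "\<And>x y. E (x + y) = E x + E y" "\<And>a x. E (\<rho> a x) = \<rho> a (E x)" "\<And>x. E (T x) = T (E x)"
  shows "E (poly_act \<rho> T p v) = poly_act \<rho> T p (E v)"
proof (induction p)
  case 0
  have "E 0 = 0" using assms(1)[of 0 0] by simp
  then show ?case by (simp add: poly_act_0)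
qed (simp add: poly_act_pCons assms)

end

section \<open>Shifts and derivatives of polynomials in two variables\<close>

lemma shift_0 [simp]: "shift c 0 = 0"
  by (simp add: shift_def)

lemma shift_pCons: "shift c (pCons a f) = [:a:] + (outer_var - const c) * shift c f"
  by (simp add: shift_def pcompose_pCons)

lemma shift_const [simp]: "shift c [:a:] = [:a:]"
  by (simp add: shift_def)

lemma shift_1 [simp]: "shift c 1 = 1"
  by (simp add: shift_def pcompose_1)

lemma shift_linear [simp]: "shift c [:a, b:] = [:a - smult c b, b:]"
  by (simp add: shift_pCons algebra_simps)

lemma shift_diff: "shift c (f - g) = shift c f - shift c g"
  by (simp add: shift_def pcompose_diff)

lemma shift_mult: "shift c (f * g) = shift c f * shift c g"
  by (simp add: shift_def pcompose_mult)

lemma shift_zero_amount [simp]: "shift 0 f = f"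
  by (induction f) (simp_all add: shift_pCons)

lemma shift_shift: "shift c (shift d f) = shift (c + d) f"
  by (simp add: shift_def pcompose_assoc[symmetric] pcompose_diff pcompose_pCons diff_diff_eq add.commute)

lemma degree_shift [simp]: "degree (shift c f) = degree f"
  by (simp add: shift_def degree_pcompose)

lemma shift_eq_0_iff [simp]: "shift c f = 0 \<longleftrightarrow> f = 0"
  by (metis shift_0 shift_shift shift_zero_amount add.commute add.right_inverse)

text \<open>
  A polynomial in \<open>s\<close> that is invariant under a nonzero translation takes the value at \<open>0\<close> infinitely often.
  All statements that a coefficient does not involve \<open>s\<close> come from here.
\<close>

lemma degree_0_if_periodic:
  assumes "shift c f = f" and "c \<noteq> 0"
  shows "degree f = 0"
proof -
  have sh: "shift (of_nat n * c) f = f" for n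
  proof (induction n)
    case (Suc n)
    have "shift (of_nat (Suc n) * c) f = shift c (shift (of_nat n * c) f)"
      by (simp add: shift_shift algebra_simps)
    then show ?case using Suc assms by simp
  qed simp
  \<comment> \<open>\<open>f\<close> takes the value \<open>f(0)\<close> at all points \<open>- n c\<close>.\<close>
  define d where "d = f - [:poly f 0:]"
  have "poly f [:- (of_nat n * c):] = poly f 0" for n
  proof -
    have "poly (shift (of_nat n * c) f) 0 = poly f [:- (of_nat n * c):]"
      by (simp add: shift_def poly_pcompose)
    then show ?thesis using sh by simp
  qed
  then have "range (\<lambda>n. [:- (of_nat n * c):]) \<subseteq> {x. poly d x = 0}"
    by (auto simp: d_def)
  moreover have "infinite (range (\<lambda>n. [:- (of_nat n * c):]))"
    using assms(2) by (intro range_inj_infinite) (auto simp: inj_def)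
  ultimately have "infinite {x. poly d x = 0}"
    using finite_subset by blast
  then have "d = 0" using poly_roots_finite by blast
  then have "f = [:poly f 0:]" by (simp add: d_def)
  then show ?thesis by (metis degree_pCons_0)
qed

text \<open>
  The linear polynomial with the same difference differs from \<open>f\<close> by a periodic polynomial.
\<close>

lemma affine_of_difference:
  assumes "shift 1 f = f - [:a:]"
  obtains b where "f = [:b, a:]"
proof -
  have "shift 1 (f - [:0, a:]) = f - [:0, a:]"
    using assms by (simp add: shift_diff)
  then have "degree (f - [:0, a:]) = 0" by (rule degree_0_if_periodic) simp
  then obtain b where "f - [:0, a:] = [:b:]" by (rule degree_eq_zeroE)
  then have "f = [:b, a:]" by (simp add: algebra_simps eq_diff_eq)
  then show thesis by (rule that)
qed

lemma d_inner_0 [simp]: "d_inner 0 = 0"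
  by (simp add: d_inner_def)

lemma coeff_d_inner: "coeff (d_inner f) i = pderiv (coeff f i)"
  by (simp add: d_inner_def coeff_map_poly)

lemma d_inner_pCons [simp]: "d_inner (pCons a f) = pCons (pderiv a) (d_inner f)"
  by (rule poly_eqI) (simp add: coeff_d_inner coeff_pCons split: nat.split)

lemma d_inner_add: "d_inner (f + g) = d_inner f + d_inner g"
  by (rule poly_eqI) (simp add: coeff_d_inner pderiv_add)

lemma d_inner_smult: "d_inner (smult a f) = smult (pderiv a) f + smult a (d_inner f)"
  by (rule poly_eqI) (simp add: coeff_d_inner pderiv_mult algebra_simps)

lemma d_inner_mult: "d_inner (f * g) = d_inner f * g + f * d_inner g"
  by (induction f) (simp_all add: d_inner_add d_inner_smult algebra_simps)

lemma d_inner_1 [simp]: "d_inner 1 = 0"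
  by (simp add: one_pCons)

section \<open>Generators of the superalgebra acting on a module\<close>

lemma lookup_ns_scale: "Poly_Mapping.lookup (ns_scale c x) b = c * Poly_Mapping.lookup x b"
  by (simp add: ns_scale_def Poly_Mapping.map.rep_eq when_def)

lemma ns_alg_expansion: "x = (\<Sum>b\<in>Poly_Mapping.keys x. ns_scale (Poly_Mapping.lookup x b) (unit_vec b))"
  by (rule poly_mapping_eqI)
     (simp add: lookup_sum lookup_ns_scale lookup_single when_def in_keys_iff if_distrib cong: if_cong)

lemma unit_vec_part: "unit_vec b \<in> ns_part (ns_parity b)"
  by (simp add: ns_part_def)

lemma ns_scale_1: "ns_scale 1 x = x"
  by (rule poly_mapping_eqI) (simp add: lookup_ns_scale)

lemma ns_bracket_unit_vec: "ns_bracket (unit_vec a) (unit_vec b) = ns_br a b"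
  by (simp add: ns_bracket_def lin_ext_def ns_scale_1)

text \<open>
  The other parity. A constant of its own keeps the sum in \<open>\<int>/2\<int>\<close> from being rewritten into a case distinction.
\<close>

definition opp :: "bit \<Rightarrow> bit" where
  "opp i = i + 1"

lemma opp_simps [simp]: "opp (opp i) = i" "opp 0 = 1" "opp 1 = 0"
  by (simp_all add: opp_def)

lemma of_bool_bit [simp]: "of_bool (i = 1) = (i::bit)"
  by (cases i) auto

locale ns_supermodule = lie_supermodule ns_scale ns_part ns_bracket scale hpart act
  for scale :: "complex \<Rightarrow> 'm::ab_group_add \<Rightarrow> 'm" and hpart act
begin

abbreviation opr :: "ns_basis \<Rightarrow> 'm \<Rightarrow> 'm" where
  "opr b \<equiv> act (unit_vec b)"

abbreviation ut :: "complex poly poly \<Rightarrow> 'm \<Rightarrow> 'm" (infixr "\<cdot>" 75) where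
  "p \<cdot> v \<equiv> UT_scale scale act p v"

lemma act_add_left: "act (x + y) v = act x v + act y v"
  and act_scale_left: "act (ns_scale c x) v = scale c (act x v)"
  and act_zero_left: "act 0 v = 0"
  and act_sum_left: "act (\<Sum>a\<in>A. f a) v = (\<Sum>a\<in>A. act (f a) v)"
proof -
  interpret a: Vector_Spaces.linear ns_scale scale "\<lambda>x. act x v" by (rule act_linear_left)
  show "act (x + y) v = act x v + act y v" "act (ns_scale c x) v = scale c (act x v)"
    "act 0 v = 0" "act (\<Sum>a\<in>A. f a) v = (\<Sum>a\<in>A. act (f a) v)"
    by (simp_all add: a.add a.scale a.sum a.zero)
qed

lemma act_add: "act x (v + w) = act x v + act x w"
  and act_scale: "act x (scale c v) = scale c (act x v)"
  and act_zero: "act x 0 = 0"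
proof -
  interpret a: Vector_Spaces.linear scale scale "act x" by (rule act_linear_right)
  show "act x (v + w) = act x v + act x w" "act x (scale c v) = scale c (act x v)" "act x 0 = 0"
    by (simp_all add: a.add a.scale a.zero)
qed

lemma act_lin_ext: "act x v = lin_ext scale (\<lambda>b. opr b v) x"
  by (subst ns_alg_expansion) (simp add: lin_ext_def act_sum_left act_scale_left)

lemma opr_bracket:
  "opr a (opr b v) - scale (koszul_sign (ns_parity a) (ns_parity b)) (opr b (opr a v)) = act (ns_br a b) v"
  using act_bracket[OF unit_vec_part unit_vec_part, of a b v] by (simp add: ns_bracket_unit_vec)

lemma L_L_commutator: "opr (L m) (opr (L n) v) - opr (L n) (opr (L m) v) =
    scale (of_int (n - m)) (opr (L (m + n)) v) + scale (cocycle m n) (opr C1 v)"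
  using opr_bracket[of "L m" "L n" v] by (simp add: koszul_sign_def act_add_left act_scale_left)

lemma L_W_commutator: "opr (L m) (opr (W n) v) - opr (W n) (opr (L m) v) =
    scale (of_int (n - m)) (opr (W (m + n)) v) + scale (cocycle m n) (opr C2 v)"
  using opr_bracket[of "L m" "W n" v] by (simp add: koszul_sign_def act_add_left act_scale_left)

lemma W_W_commute: "opr (W m) (opr (W n) v) = opr (W n) (opr (W m) v)"
  using opr_bracket[of "W m" "W n" v] by (simp add: koszul_sign_def act_zero_left)

lemma L_G_commutator: "opr (L m) (opr (G k) v) - opr (G k) (opr (L m) v) =
    scale (half k - of_int m / 2) (opr (G (m + k)) v)"
  using opr_bracket[of "L m" "G k" v] by (simp add: koszul_sign_def act_scale_left)

lemma W_G_commute: "opr (W m) (opr (G k) v) = opr (G k) (opr (W m) v)"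
  using opr_bracket[of "W m" "G k" v] by (simp add: koszul_sign_def act_zero_left)

lemma G_G_anticommutator: "opr (G j) (opr (G k) v) + opr (G k) (opr (G j) v) =
    scale 2 (opr (W (j + k + 1)) v) +
    scale (if j + k + 1 = 0 then (half j ^ 2 - 1/4) / 3 else 0) (opr C2 v)"
  using opr_bracket[of "G j" "G k" v] by (simp add: koszul_sign_def act_add_left act_scale_left)

lemma central_commute: "c = C1 \<or> c = C2 \<Longrightarrow> b = L 0 \<or> b = W 0 \<Longrightarrow> opr c (opr b v) = opr b (opr c v)"
  using opr_bracket[of c b v] by (auto simp: koszul_sign_def act_zero_left)

lemma L0_W0_commute: "opr (L 0) (opr (W 0) v) = opr (W 0) (opr (L 0) v)"
  using L_W_commutator[of 0 0 v] by (simp add: cocycle_def)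

sublocale W0: module_endo scale "opr (W 0)"
  by unfold_locales (simp_all add: act_add act_scale)

sublocale UT0: module_endo "poly_act scale (opr (W 0))" "opr (L 0)"
proof -
  interpret C: module "poly_act scale (opr (W 0))" by (rule W0.module_poly_act)
  show "module_endo (poly_act scale (opr (W 0))) (opr (L 0))"
    by unfold_locales (simp_all add: act_add W0.poly_act_commute act_scale L0_W0_commute)
qed

lemma UT_scale_eq_poly_act: "UT_scale scale act = poly_act (poly_act scale (opr (W 0))) (opr (L 0))"
proof (intro ext)
  fix p v
  have "(opr (W 0) ^^ j) ((opr (L 0) ^^ i) v) = (opr (L 0) ^^ i) ((opr (W 0) ^^ j) v)" for i j
  proof (induction j)
    case (Suc j)
    have "opr (W 0) ((opr (L 0) ^^ i) w) = (opr (L 0) ^^ i) (opr (W 0) w)" for w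
      by (induction i) (simp_all add: L0_W0_commute[symmetric])
    then show ?case using Suc by simp
  qed simp
  then show "p \<cdot> v = poly_act (poly_act scale (opr (W 0))) (opr (L 0)) p v"
    by (simp add: UT_scale_def poly_act_def)
qed

sublocale UT: module "UT_scale scale act"
  unfolding UT_scale_eq_poly_act by (rule UT0.module_poly_act)

lemma ut_const [simp]: "const c \<cdot> v = scale c v"
  by (simp add: UT_scale_eq_poly_act UT0.poly_act_const W0.poly_act_const)

lemma ut_inner_var: "inner_var \<cdot> v = opr (W 0) v"
  by (simp add: UT_scale_eq_poly_act UT0.poly_act_const W0.poly_act_pCons W0.poly_act_0 act_zero)

lemma ut_outer_var: "outer_var \<cdot> v = opr (L 0) v"
  by (simp add: UT_scale_eq_poly_act UT0.poly_act_pCons UT0.poly_act_0 W0.poly_act_0 act_zero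
      W0.poly_act_const flip: pCons_one)

lemma ut_pCons: "pCons c f \<cdot> v = [:c:] \<cdot> v + opr (L 0) (f \<cdot> v)"
  unfolding ut_outer_var[symmetric] UT.scale_scale UT.scale_left_distrib[symmetric]
  by simp

text \<open>
  An operator that commutes with \<open>W\<^sub>0\<close> and raises the eigenvalues of \<open>L\<^sub>0\<close> by \<open>\<mu>\<close> moves past a polynomial at the price
  of the substitution \<open>s \<mapsto> s - \<mu>\<close>.
\<close>

lemma weight_operator_ut:
  assumes add: "\<And>x y. E (x + y) = E x + E y" and sc: "\<And>c x. E (scale c x) = scale c (E x)"
    and L0: "\<And>x. E (opr (L 0) x) = opr (L 0) (E x) - scale \<mu> (E x)"
    and W0: "\<And>x. E (opr (W 0) x) = opr (W 0) (E x)"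
  shows "E (f \<cdot> v) = shift \<mu> f \<cdot> E v"
proof (induction f)
  case 0
  have "E 0 = 0" using add[of 0 0] by simp
  then show ?case by simp
next
  case (pCons c f)
  have "E ([:c:] \<cdot> v) = [:c:] \<cdot> E v"
    using W0.poly_act_commute[of E, OF add sc W0]
    by (simp add: UT_scale_eq_poly_act UT0.poly_act_const)
  moreover have "E (opr (L 0) (f \<cdot> v)) = outer_var \<cdot> shift \<mu> f \<cdot> E v - const \<mu> \<cdot> shift \<mu> f \<cdot> E v"
    by (simp only: L0 pCons.IH ut_outer_var ut_const)
  ultimately show ?case
    by (simp only: ut_pCons[of c f] add shift_pCons UT.scale_left_distrib UT.scale_scale
        UT.scale_left_diff_distrib left_diff_distrib)
qed

lemma W_ut: "opr (W m) (f \<cdot> v) = shift (of_int m) f \<cdot> opr (W m) v"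
  using L_W_commutator[of 0 m]
  by (intro weight_operator_ut) (simp_all add: act_add act_scale cocycle_def W_W_commute algebra_simps)

lemma G_ut: "opr (G k) (f \<cdot> v) = shift (half k) f \<cdot> opr (G k) v"
  using L_G_commutator[of 0 k] W_G_commute[of 0 k]
  by (intro weight_operator_ut) (simp_all add: act_add act_scale algebra_simps)

lemma C_ut: "c = C1 \<or> c = C2 \<Longrightarrow> opr c (f \<cdot> v) = f \<cdot> opr c v"
  using weight_operator_ut[of "opr c" 0 f v] central_commute[of c] by (auto simp: act_add act_scale)

text \<open>
  Since \<open>L\<^sub>m W\<^sub>0 = W\<^sub>0 L\<^sub>m - m W\<^sub>m\<close>, the operator \<open>L\<^sub>m\<close> differentiates polynomials in \<open>t\<close>.
\<close>

lemma L_ut_inner: "opr (L m) ([:c:] \<cdot> v) = [:c:] \<cdot> opr (L m) v - (const (of_int m) * [:pderiv c:]) \<cdot> opr (W m) v"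
proof (induction c)
  case 0
  then show ?case by (simp add: act_zero)
next
  case (pCons a c)
  have split: "[:pCons a c:] = const a + inner_var * [:c:]" by simp
  have "opr (L m) (inner_var \<cdot> x) = inner_var \<cdot> opr (L m) x - const (of_int m) \<cdot> opr (W m) x" for x
    using L_W_commutator[of m 0 x] by (simp add: cocycle_def algebra_simps ut_inner_var)
  note this[of "[:c:] \<cdot> v"]
  then have "opr (L m) ([:pCons a c:] \<cdot> v) = const a \<cdot> opr (L m) v +
      (inner_var \<cdot> opr (L m) ([:c:] \<cdot> v) - const (of_int m) \<cdot> opr (W m) ([:c:] \<cdot> v))"
    unfolding split UT.scale_left_distrib UT.scale_scale[symmetric] by (simp add: act_add act_scale)
  also have "\<dots> = (const a + inner_var * [:c:]) \<cdot> opr (L m) v -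
      (const (of_int m) * (inner_var * [:pderiv c:] + [:c:])) \<cdot> opr (W m) v"
    unfolding pCons.IH W_ut UT.scale_left_distrib UT.scale_right_diff_distrib UT.scale_scale shift_const
    by (simp only: UT.scale_left_distrib distrib_left mult.assoc mult.left_commute[of inner_var]) simp
  also have "inner_var * [:pderiv c:] + [:c:] = [:pderiv (pCons a c):]"
    by (simp add: pderiv_pCons)
  finally show ?case by (simp only: split)
qed

text \<open>
  The two effects combined: \<open>L\<^sub>m\<close> has weight \<open>m\<close> and differentiates in the direction of \<open>t\<close>.
\<close>

lemma L_ut: "opr (L m) (f \<cdot> v) = shift (of_int m) f \<cdot> opr (L m) v -
    (const (of_int m) * d_inner (shift (of_int m) f)) \<cdot> opr (W m) v"
proof (induction f)
  case 0
  then show ?case by (simp add: act_zero)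
next
  case (pCons c f)
  define X where "X = outer_var - const (of_int m)"
  have "opr (L m) (opr (L 0) x) = X \<cdot> opr (L m) x" for x
    using L_L_commutator[of m 0 x]
    by (simp add: cocycle_def algebra_simps X_def UT.scale_left_diff_distrib ut_outer_var
          del: diff_pCons)
  then have "opr (L m) (pCons c f \<cdot> v) = opr (L m) ([:c:] \<cdot> v) + X \<cdot> opr (L m) (f \<cdot> v)"
    by (simp only: ut_pCons[of c f] act_add)
  also have "\<dots> = ([:c:] + X * shift (of_int m) f) \<cdot> opr (L m) v -
      (const (of_int m) * ([:pderiv c:] + X * d_inner (shift (of_int m) f))) \<cdot> opr (W m) v"
    unfolding L_ut_inner pCons.IH UT.scale_right_diff_distrib UT.scale_scale
    by (simp only: UT.scale_left_distrib distrib_left mult.left_commute[of X]) simp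
  also have "[:c:] + X * shift (of_int m) f = shift (of_int m) (pCons c f)"
    by (simp add: shift_pCons X_def)
  also have "[:pderiv c:] + X * d_inner (shift (of_int m) f) = d_inner (shift (of_int m) (pCons c f))"
    unfolding shift_pCons X_def[symmetric]
    by (simp add: d_inner_add d_inner_mult) (simp add: X_def)
  finally show ?case .
qed

lemma hpart_ut: "x \<in> hpart i \<Longrightarrow> f \<cdot> x \<in> hpart i"
proof -
  assume x: "x \<in> hpart i"
  have b: "opr (L 0) y \<in> hpart i" "opr (W 0) y \<in> hpart i" if "y \<in> hpart i" for y
    using act_part[OF unit_vec_part that, of "L 0"] act_part[OF unit_vec_part that, of "W 0"] by simp_all
  have "(opr (L 0) ^^ m) y \<in> hpart i" if "y \<in> hpart i" for m y
    using that by (induction m) (simp_all add: b)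
  moreover have "(opr (W 0) ^^ n) x \<in> hpart i" for n
    using x by (induction n) (simp_all add: b)
  ultimately show ?thesis
    unfolding UT_scale_def by (intro M.subspace_sum M.subspace_scale M.subspace_part) auto
qed

end

section \<open>Coefficients of the generators on a homogeneous basis\<close>

locale ns_free_module = ns_supermodule scale hpart act
  for scale :: "complex \<Rightarrow> 'm::ab_group_add \<Rightarrow> 'm" and hpart act +
  fixes v :: "bit \<Rightarrow> 'm"
  assumes v_part: "v i \<in> hpart i"
    and v_span: "\<exists>f k. x = f \<cdot> v 0 + k \<cdot> v 1"
    and v_indep: "f \<cdot> v 0 + k \<cdot> v 1 = 0 \<Longrightarrow> f = 0 \<and> k = 0"
begin

lemma ut_v_eq_iff [simp]: "f \<cdot> v i = g \<cdot> v i \<longleftrightarrow> f = g"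
proof
  assume "f \<cdot> v i = g \<cdot> v i"
  then have "(f - g) \<cdot> v i = 0" by (simp add: UT.scale_left_diff_distrib)
  then show "f = g" using v_indep[of "f - g" 0] v_indep[of 0 "f - g"] by (cases i) auto
qed simp

text \<open>
  The coordinate at the basis vector of the other parity gives an element in both homogeneous parts, hence zero.
\<close>

lemma hpart_coordinate:
  assumes "x \<in> hpart i"
  shows "\<exists>f. x = f \<cdot> v i"
proof -
  obtain f k where x: "x = f \<cdot> v 0 + k \<cdot> v 1" using v_span by blast
  have i0: "y = 0" if "y \<in> hpart 0" "y \<in> hpart 1" for y
    using M.part_Int that by blast
  show ?thesis
  proof (cases i)
    case zero
    then have "k \<cdot> v 1 = x - f \<cdot> v 0" using x by simp
    also have "\<dots> \<in> hpart 0"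
      using assms zero by (intro M.subspace_diff M.subspace_part hpart_ut v_part) simp
    finally have "k \<cdot> v 1 = 0" using i0 hpart_ut[OF v_part] by blast
    then show ?thesis using x zero by auto
  next
    case one
    then have "f \<cdot> v 0 = x - k \<cdot> v 1" using x by simp
    also have "\<dots> \<in> hpart 1"
      using assms one by (intro M.subspace_diff M.subspace_part hpart_ut v_part) simp
    finally have "f \<cdot> v 0 = 0" using i0 hpart_ut[OF v_part] by blast
    then show ?thesis using x one by auto
  qed
qed

lemma opr_basis_vector: "\<exists>f. opr b (v i) = f \<cdot> v (ns_parity b + i)"
  by (rule hpart_coordinate[OF act_part[OF unit_vec_part v_part]])

text \<open>
  The action in coordinates. The free basis makes these polynomials unique, which is how equations between vectors become
  equations between polynomials.
\<close>

definition Wc where "Wc m i = (SOME f. opr (W m) (v i) = f \<cdot> v i)"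
definition Lc where "Lc m i = (SOME f. opr (L m) (v i) = f \<cdot> v i)"
definition Gc where "Gc k i = (SOME f. opr (G k) (v i) = f \<cdot> v (opp i))"

lemma W_basis_vector: "opr (W m) (v i) = Wc m i \<cdot> v i"
  unfolding Wc_def by (rule someI_ex) (use opr_basis_vector[of "W m" i] in simp)

lemma L_basis_vector: "opr (L m) (v i) = Lc m i \<cdot> v i"
  unfolding Lc_def by (rule someI_ex) (use opr_basis_vector[of "L m" i] in simp)

lemma G_basis_vector: "opr (G k) (v i) = Gc k i \<cdot> v (opp i)"
  unfolding Gc_def by (rule someI_ex) (use opr_basis_vector[of "G k" i] in \<open>simp add: opp_def add.commute\<close>)

end

section \<open>The first modes\<close>

text \<open>
  Multiplied by \<open>q\<close>, the left-hand side is the derivative of \<open>q\<^sup>2 p\<close>. If \<open>r\<close> is constant and \<open>q\<close> quadratic, then \<open>q\<^sup>2 p\<close>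
  would have degree three, whereas \<open>q\<^sup>2\<close> already has degree four.
\<close>

lemma constant_partner_not_quadratic:
  fixes p q r :: "complex poly"
  assumes eq: "2 * pderiv q * p + q * pderiv p = 3 * r" and "degree r = 0" "r \<noteq> 0"
  shows "degree q \<noteq> 2"
proof
  assume q: "degree q = 2"
  then have "q \<noteq> 0" by auto
  have "pderiv (q * q * p) = q * (2 * pderiv q * p + q * pderiv p)"
    by (simp add: pderiv_mult algebra_simps)
  then have d: "pderiv (q * q * p) = q * (3 * r)" by (simp add: eq)
  have "3 * r = smult 3 r" by (simp add: numeral_poly)
  then have "degree (q * (3 * r)) = 2" using q \<open>degree r = 0\<close> \<open>r \<noteq> 0\<close> \<open>q \<noteq> 0\<close> by (simp add: degree_mult_eq)
  then have d3: "degree (q * q * p) = 3" using d degree_pderiv[of "q * q * p"] by simp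
  then have "p \<noteq> 0" by auto
  then show False using d3 q \<open>q \<noteq> 0\<close> by (simp add: degree_mult_eq)
qed

text \<open>
  From \<open>(u - w)\<^sup>2 = (u + w)\<^sup>2 - 4 u w\<close> the derivative of \<open>(u - w)\<^sup>2\<close> vanishes, so \<open>u - w\<close> is a constant.
\<close>

lemma sum_product_linear:
  fixes u w :: "complex poly"
  assumes s: "u + w = [:0, 2:]" and d: "pderiv (u * w) = [:0, 2:]"
  obtains \<alpha> where "u = [:- \<alpha>, 1:]" "w = [:\<alpha>, 1:]"
proof -
  have "pderiv ((u - w) * (u - w)) = pderiv ((u + w) * (u + w) - 4 * (u * w))"
    by (simp add: algebra_simps)
  also have "\<dots> = 0"
    unfolding pderiv_diff pderiv_mult[of 4] s d by (simp add: pderiv_pCons numeral_poly)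
  finally have "degree ((u - w) * (u - w)) = 0"
    by (simp add: pderiv_eq_0_iff)
  then have "degree (u - w) = 0"
    by (cases "u - w = 0") (auto simp: degree_mult_eq)
  then obtain c where c: "u - w = [:c:]" by (rule degree_eq_zeroE)
  have "smult 2 u = (u + w) + (u - w)" "smult 2 w = (u + w) - (u - w)"
    by (simp_all add: numeral_poly flip: mult_2)
  then have "smult 2 u = [:c, 2:]" "smult 2 w = [:- c, 2:]"
    unfolding s c by simp_all
  then have "smult 2 u = smult 2 [:c/2, 1:]" "smult 2 w = smult 2 [:- c / 2, 1:]"
    by simp_all
  then have "u = [:c/2, 1:]" "w = [:- c / 2, 1:]"
    by (metis smult_cancel zero_neq_numeral)+
  then show thesis by (intro that[of "- c / 2"]) simp_all
qed

context ns_free_module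
begin

lemmas coordinate_simps = W_basis_vector L_basis_vector G_basis_vector L_ut W_ut G_ut ut_const[symmetric] UT.scale_scale
  UT.scale_left_diff_distrib[symmetric] UT.scale_left_distrib[symmetric] opp_simps

text \<open>
  The defining brackets evaluated at a basis vector. The assumption on the cocycle removes the central term, whose value
  is determined only at the very end.
\<close>

lemma Lc_Wc_relation:
  assumes "cocycle m n = 0"
  shows "shift (of_int m) (Wc n i) * Lc m i - const (of_int m) * d_inner (shift (of_int m) (Wc n i)) * Wc m i
     - shift (of_int n) (Lc m i) * Wc n i = const (of_int (n - m)) * Wc (m + n) i"
proof -
  have "opr (L m) (opr (W n) (v i)) - opr (W n) (opr (L m) (v i)) = const (of_int (n - m)) \<cdot> opr (W (m + n)) (v i)"
    using L_W_commutator[of m n "v i"] assms by simp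
  then show ?thesis by (simp only: coordinate_simps ut_v_eq_iff)
qed

lemma Wc_Wc_relation: "shift (of_int m) (Wc n i) * Wc m i = shift (of_int n) (Wc m i) * Wc n i"
  using W_W_commute[of m n "v i"] by (simp only: coordinate_simps ut_v_eq_iff)

lemma Lc_Gc_relation: "shift (of_int m) (Gc k i) * Lc m (opp i) - const (of_int m) * d_inner (shift (of_int m) (Gc k i)) * Wc m (opp i)
     - shift (half k) (Lc m i) * Gc k i = const (half k - of_int m / 2) * Gc (m + k) i"
  using L_G_commutator[of m k "v i"] by (simp only: coordinate_simps ut_v_eq_iff)

lemma Gc_Gc_relation:
  assumes "j + k + 1 = 0 \<Longrightarrow> half j ^ 2 = 1/4"
  shows "shift (half j) (Gc k i) * Gc j (opp i) + shift (half k) (Gc j i) * Gc k (opp i) = const 2 * Wc (j + k + 1) i"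
proof -
  have "opr (G j) (opr (G k) (v i)) + opr (G k) (opr (G j) (v i)) = const 2 \<cdot> opr (W (j + k + 1)) (v i)"
    using G_G_anticommutator[of j k "v i"] assms by (auto split: if_splits)
  then show ?thesis by (simp only: coordinate_simps ut_v_eq_iff)
qed

lemma Lc_Lc_relation:
  assumes "cocycle m n = 0"
  shows "(shift (of_int m) (Lc n i) * Lc m i - const (of_int m) * d_inner (shift (of_int m) (Lc n i)) * Wc m i)
     - (shift (of_int n) (Lc m i) * Lc n i - const (of_int n) * d_inner (shift (of_int n) (Lc m i)) * Wc n i)
     = const (of_int (n - m)) * Lc (m + n) i"
proof -
  have "opr (L m) (opr (L n) (v i)) - opr (L n) (opr (L m) (v i)) = const (of_int (n - m)) \<cdot> opr (L (m + n)) (v i)"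
    using L_L_commutator[of m n "v i"] assms by simp
  then show ?thesis by (simp only: coordinate_simps ut_v_eq_iff)
qed

lemma Wc_0: "Wc 0 i = inner_var"
  using W_basis_vector[of 0 i] by (simp flip: ut_inner_var)

lemma Lc_0: "Lc 0 i = outer_var"
  using L_basis_vector[of 0 i] by (simp flip: ut_outer_var)

text \<open>
  Brackets with \<open>L\<^bsub>\<plusminus>1\<^esub>\<close> carry no central term, so they are available for recursion in \<open>n\<close>. The sign \<open>e\<close> treats
  positive and negative indices at the same time.
\<close>

lemma cocycle_sl2: "e = 1 \<or> e = -1 \<Longrightarrow> cocycle (- e) (e * n) = 0"
  unfolding cocycle_def by (cases "n = 1") auto

text \<open>
  If \<open>W\<^sub>e\<close> annihilated a basis vector, its bracket with \<open>L\<^bsub>-e\<^esub>\<close> would do so as well; but that is a nonzero multiple of \<open>W\<^sub>0\<close>.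
\<close>

lemma Wc_nonzero:
  assumes e: "e = 1 \<or> e = -1"
  shows "Wc e i \<noteq> 0"
proof
  assume "Wc e i = 0"
  then have "const (of_int (2 * e)) * Wc 0 i = 0"
    using Lc_Wc_relation[of "- e" e i] cocycle_sl2[OF e, of 1] by simp
  then show False using e by (auto simp: Wc_0)
qed

lemma shift_degree_0: "degree f = 0 \<Longrightarrow> shift c f = f"
  by (metis degree_eq_zeroE shift_const)

text \<open>
  Commutation of \<open>W\<^sub>1\<close> and \<open>W\<^bsub>-1\<^esub>\<close> says that \<open>F(s) = Wc 1 (s) \<cdot> Wc (-1) (s - 1)\<close> is periodic. So both factors, being nonzero,
  are free of \<open>s\<close>, and commutation of \<open>W\<^sub>m\<close> with \<open>W\<^sub>1\<close> makes every \<open>Wc m\<close> periodic.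
\<close>

lemma Wc_degree: "degree (Wc m i) = 0"
proof -
  have nz: "Wc 1 i \<noteq> 0" "Wc (-1) i \<noteq> 0" by (simp_all add: Wc_nonzero)
  define F where "F = Wc 1 i * shift 1 (Wc (-1) i)"
  have "F = shift (-1) (Wc 1 i) * Wc (-1) i"
    using Wc_Wc_relation[of 1 "-1" i] by (simp add: F_def mult.commute)
  then have "shift 1 F = F"
    by (simp add: F_def shift_mult shift_shift)
  then have "degree F = 0" by (rule degree_0_if_periodic) simp
  then have W1: "degree (Wc 1 i) = 0"
    using nz by (simp add: F_def degree_mult_eq)
  have "shift 1 (Wc m i) * Wc 1 i = Wc m i * Wc 1 i"
    using Wc_Wc_relation[of m 1 i] shift_degree_0[OF W1] by (metis mult.commute of_int_1)
  then have "shift 1 (Wc m i) = Wc m i" using nz by simp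
  then show ?thesis by (rule degree_0_if_periodic) simp
qed

text \<open>
  The coefficient of \<open>W\<^sub>m\<close>, as a polynomial in \<open>t\<close> alone.
\<close>

definition w where "w m i = coeff (Wc m i) 0"

lemma Wc_w: "Wc m i = [:w m i:]"
  unfolding w_def using Wc_degree by (metis degree_eq_zeroE coeff_pCons_0)

lemma w_0: "w 0 i = [:0, 1:]"
  using Wc_0[of i] by (simp add: Wc_w)

lemma w_nonzero: "e = 1 \<or> e = -1 \<Longrightarrow> w e i \<noteq> 0"
  using Wc_nonzero[of e i] by (simp add: Wc_w)

text \<open>
  \<open>G\<^sub>r\<close> squares to \<open>W\<^bsub>2r\<^esub>\<close>; as \<open>2r\<close> is odd, no central term occurs.
\<close>

lemma G_square: "shift (half k) (Gc k i) * Gc k (opp i) = [:w (2 * k + 1) i:]"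
proof -
  have "2 * k + 1 \<noteq> 0" by presburger
  moreover have "const 2 * X = X + X" for X
  proof -
    have "const 2 = 1 + 1" by (simp add: one_pCons)
    then show ?thesis by (simp only: distrib_right mult_1_left)
  qed
  ultimately have "const 2 * (shift (half k) (Gc k i) * Gc k (opp i)) = const 2 * [:w (2 * k + 1) i:]"
    using Gc_Gc_relation[of k k i] by (simp only: Wc_w mult_2)
  then show ?thesis by (metis mult_left_cancel pCons_eq_0_iff zero_neq_numeral)
qed

text \<open>
  For \<open>k = 0\<close> and \<open>k = -1\<close>, that is for \<open>G\<^bsub>\<plusminus>1/2\<^esub>\<close>, the coefficient \<open>Gc k i\<close> will turn out to be this polynomial in \<open>t\<close>.
\<close>

definition \<gamma> where "\<gamma> k i = coeff (Gc k i) 0"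

text \<open>
  A product free of \<open>s\<close> has factors free of \<open>s\<close>.
\<close>

lemma Gc_\<gamma>:
  assumes "k = 0 \<or> k = -1"
  shows "Gc k i = [:\<gamma> k i:]" "w (2 * k + 1) i = \<gamma> k i * \<gamma> k (opp i)" "\<gamma> k i \<noteq> 0"
proof -
  have nz: "[:w (2 * k + 1) i:] \<noteq> 0" for i using w_nonzero[of "2 * k + 1" i] assms by auto
  have "degree (Gc k i) = 0" for i
  proof -
    have "degree (shift (half k) (Gc k i) * Gc k (opp i)) = 0" unfolding G_square by simp
    moreover have "shift (half k) (Gc k i) \<noteq> 0" "Gc k (opp i) \<noteq> 0"
      using nz G_square[of k i] by auto
    ultimately show ?thesis by (simp add: degree_mult_eq)
  qed
  then show G: "Gc k i = [:\<gamma> k i:]" for i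
    unfolding \<gamma>_def by (metis degree_eq_zeroE coeff_pCons_0)
  show "w (2 * k + 1) i = \<gamma> k i * \<gamma> k (opp i)"
    using G_square[of k i] by (simp add: G mult.commute)
  then show "\<gamma> k i \<noteq> 0" using nz[of i] by auto
qed

lemma \<gamma>_anticommutator: "\<gamma> (-1) i * \<gamma> 0 (opp i) + \<gamma> 0 i * \<gamma> (-1) (opp i) = [:0, 2:]"
  using Gc_Gc_relation[of 0 "-1" i] by (simp add: Gc_\<gamma> Wc_0 half_def power2_eq_square mult.commute)

text \<open>
  This is the relation that \<open>L\<^sub>e\<close> commutes with \<open>G\<^bsub>e/2\<^esub>\<close>, divided by the coefficient of \<open>G\<^bsub>e/2\<^esub>\<close>.
\<close>

lemma L_unit_half_step:
  assumes k: "k = 0 \<or> k = -1" and e: "e = 2 * k + 1"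
  shows "Lc e (opp i) - shift (half k) (Lc e i) = [:of_int e * (\<gamma> k (opp i) * pderiv (\<gamma> k i)):]"
proof -
  have "half k = of_int e / 2" by (simp add: e half_def field_simps)
  moreover have we: "w e (opp i) = \<gamma> k i * \<gamma> k (opp i)"
    using Gc_\<gamma>(2)[OF k, of "opp i"] by (simp add: e mult.commute)
  ultimately have "[:\<gamma> k i:] * (Lc e (opp i) - shift (half k) (Lc e i)) =
      [:\<gamma> k i:] * [:of_int e * (\<gamma> k (opp i) * pderiv (\<gamma> k i)):]"
    using Lc_Gc_relation[of e k i]
    by (simp add: Gc_\<gamma>(1)[OF k] Wc_w we of_int_poly algebra_simps)
  then show ?thesis using Gc_\<gamma>(3)[OF k, of i] by (metis mult_left_cancel pCons_eq_0_iff)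
qed

text \<open>
  Two half steps, from \<open>v i\<close> to \<open>v (opp i)\<close> and back, give the difference of \<open>Lc e i\<close> under a full shift; the two
  derivative terms add up to the derivative of \<open>w e i\<close> by the product rule.
\<close>

lemma L_unit_affine:
  assumes "e = 1 \<or> e = -1"
  obtains b where "Lc e i = [:b, pderiv (w e i):]"
proof -
  \<comment> \<open>The index \<open>k\<close> of \<open>G\<^bsub>e/2\<^esub>\<close>, that is \<open>k = 0\<close> for \<open>e = 1\<close> and \<open>k = -1\<close> for \<open>e = -1\<close>.\<close>
  define k where "k = (e - 1) div 2"
  have k: "k = 0 \<or> k = -1" and e: "e = 2 * k + 1" using assms by (auto simp: k_def)
  have hh: "half k + half k = of_int e" by (simp add: e half_def)
  have "Lc e i - shift (of_int e) (Lc e i) =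
      (Lc e (opp (opp i)) - shift (half k) (Lc e (opp i))) +
      shift (half k) (Lc e (opp i) - shift (half k) (Lc e i))"
    by (simp add: shift_diff shift_shift hh)
  also have "\<dots> = [:of_int e * pderiv (w e i):]"
    unfolding L_unit_half_step[OF k e] using Gc_\<gamma>(2)[OF k, of i, folded e]
    by (simp add: pderiv_mult algebra_simps)
  finally have d: "Lc e i - shift (of_int e) (Lc e i) = [:of_int e * pderiv (w e i):]" .
  have "shift 1 (Lc e i) = Lc e i - [:pderiv (w e i):]"
  proof (cases "e = 1")
    case True
    then show ?thesis using d by (simp add: algebra_simps)
  next
    case False
    then have "shift 1 (Lc e i - shift (-1) (Lc e i)) = shift 1 (- [:pderiv (w e i):])"
      using d assms by auto
    then show ?thesis by (simp add: shift_diff shift_shift algebra_simps)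
  qed
  then show thesis by (rule affine_of_difference) (rule that)
qed

lemma w_unit_product: "pderiv (w 1 i * w (-1) i) = [:0, 2:]"
proof -
  obtain b where "Lc 1 i = [:b, pderiv (w 1 i):]" using L_unit_affine[of 1 i] by auto
  then have "- (w 1 i * pderiv (w (-1) i)) - w (-1) i * pderiv (w 1 i) = [:0, -2:]"
    using Lc_Wc_relation[of 1 "-1" i] by (simp add: Wc_w w_0 cocycle_def algebra_simps)
  then have "- pderiv (w 1 i * w (-1) i) = - [:0, 2:]"
    by (simp add: pderiv_mult algebra_simps)
  then show ?thesis by (simp only: neg_equal_iff_equal)
qed

text \<open>
  The bracket of \<open>L\<^bsub>-e\<^esub>\<close> and \<open>W\<^bsub>en\<^esub>\<close>. Only the leading coefficient of \<open>Lc (-e) i\<close> enters, because its constant term is not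
  changed by the shift.
\<close>

lemma w_recurrence:
  assumes e: "e = 1 \<or> e = -1"
  shows "of_int n * pderiv (w (- e) i) * w (e * n) i + w (- e) i * pderiv (w (e * n) i) =
    of_int (n + 1) * w (e * (n - 1)) i"
proof -
  obtain b where "Lc (-e) i = [:b, pderiv (w (-e) i):]" using L_unit_affine[of "-e" i] e by auto
  then have "[:of_int e * (of_int n * pderiv (w (- e) i) * w (e * n) i + w (- e) i * pderiv (w (e * n) i)):] =
      [:of_int e * (of_int (n + 1) * w (e * (n - 1)) i):]"
    using Lc_Wc_relation[OF cocycle_sl2[OF e, of n], of i]
    by (simp add: Wc_w of_int_poly algebra_simps)
  then show ?thesis using e by auto
qed

text \<open>
  The two linear polynomials \<open>t \<mp> \<alpha>\<close> are products of a coefficient of \<open>G\<^bsub>1/2\<^esub>\<close> and one of \<open>G\<^bsub>-1/2\<^esub>\<close> on opposite basis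
  vectors. If the two constant factors do not belong to the same basis vector, then one of \<open>w (\<plusminus>1)\<close> is constant and the
  other is quadratic, against the recurrence for \<open>n = 2\<close>.
\<close>

lemma odd_operators_scalar:
  obtains i c d where "c \<noteq> 0" "d \<noteq> 0" "opr (G 0) (v i) = scale c (v (opp i))"
    "opr (G (-1)) (v i) = scale d (v (opp i))"
proof -
  have prod: "w 1 0 = \<gamma> 0 0 * \<gamma> 0 1" "w (-1) 0 = \<gamma> (-1) 0 * \<gamma> (-1) 1"
    using Gc_\<gamma>(2)[of 0 0] Gc_\<gamma>(2)[of "-1" 0] by simp_all
  have nz: "\<gamma> 0 i \<noteq> 0" "\<gamma> (-1) i \<noteq> 0" for i by (simp_all add: Gc_\<gamma>)
  have "pderiv ((\<gamma> (-1) 0 * \<gamma> 0 1) * (\<gamma> 0 0 * \<gamma> (-1) 1)) = [:0, 2:]"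
    using w_unit_product[of 0] by (simp add: prod mult_ac)
  then obtain \<alpha> where "\<gamma> (-1) 0 * \<gamma> 0 1 = [:- \<alpha>, 1:]" "\<gamma> 0 0 * \<gamma> (-1) 1 = [:\<alpha>, 1:]"
    using \<gamma>_anticommutator[of 0] by (auto elim: sum_product_linear)
  then have "degree (\<gamma> (-1) 0 * \<gamma> 0 1) = 1" "degree (\<gamma> 0 0 * \<gamma> (-1) 1) = 1"
    by simp_all
  then have deg: "degree (\<gamma> (-1) 0) + degree (\<gamma> 0 1) = 1" "degree (\<gamma> 0 0) + degree (\<gamma> (-1) 1) = 1"
    using nz by (simp_all add: degree_mult_eq)
  have wdeg: "degree (w 1 0) = degree (\<gamma> 0 0) + degree (\<gamma> 0 1)"
    "degree (w (-1) 0) = degree (\<gamma> (-1) 0) + degree (\<gamma> (-1) 1)"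
    using nz by (simp_all add: prod degree_mult_eq)
  have "degree (w 1 0) = 0 \<Longrightarrow> degree (w (-1) 0) \<noteq> 2"
    using constant_partner_not_quadratic[of "w (-1) 0" "w 2 0" "w 1 0"] w_recurrence[of 1 2 0] w_nonzero[of 1 0] by simp
  moreover have "degree (w (-1) 0) = 0 \<Longrightarrow> degree (w 1 0) \<noteq> 2"
    using constant_partner_not_quadratic[of "w 1 0" "w (-2) 0" "w (-1) 0"] w_recurrence[of "-1" 2 0] w_nonzero[of "-1" 0] by simp
  ultimately have "(degree (\<gamma> 0 0) = 0 \<and> degree (\<gamma> (-1) 0) = 0) \<or> (degree (\<gamma> 0 1) = 0 \<and> degree (\<gamma> (-1) 1) = 0)"
    using deg wdeg by linarith
  then obtain i where i: "degree (\<gamma> 0 i) = 0" "degree (\<gamma> (-1) i) = 0" by blast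
  obtain c where c: "\<gamma> 0 i = [:c:]" using i(1) by (rule degree_eq_zeroE)
  obtain d where d: "\<gamma> (-1) i = [:d:]" using i(2) by (rule degree_eq_zeroE)
  have "c \<noteq> 0" "d \<noteq> 0" using nz[of i] c d by auto
  moreover have "opr (G 0) (v i) = scale c (v (opp i))" "opr (G (-1)) (v i) = scale d (v (opp i))"
    using G_basis_vector[of 0 i] G_basis_vector[of "-1" i] by (simp_all add: Gc_\<gamma> c d)
  ultimately show thesis by (rule that)
qed

end

section \<open>Uniqueness for the recurrences and their solution\<close>

text \<open>
  Multiplied by \<open>q\<^bsup>n-1\<^esup>\<close>, the operator becomes \<open>p \<mapsto> (q\<^sup>n p)'\<close>. So the difference of two polynomials with the same image,
  times \<open>q\<^sup>n\<close>, is constant.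
\<close>

lemma euler_operator_injective:
  fixes p q r :: "complex poly"
  assumes eq: "of_nat n * pderiv q * p + q * pderiv p = of_nat n * pderiv q * r + q * pderiv r"
    and n: "n > 0" and q: "degree q > 0"
  shows "p = r"
proof (rule ccontr)
  define d where "d = p - r"
  assume "p \<noteq> r"
  then have d: "d \<noteq> 0" by (simp add: d_def)
  have "q \<noteq> 0" using q by auto
  obtain m where m: "n = Suc m" using n by (auto simp: gr0_conv_Suc)
  have z: "of_nat n * pderiv q * d + q * pderiv d = 0"
    using eq by (simp add: d_def pderiv_diff algebra_simps)
  have "pderiv (q ^ Suc m) = of_nat (Suc m) * q ^ m * pderiv q"
    by (simp only: pderiv_power_Suc of_nat_poly) simp
  then have "pderiv (q ^ n * d) = q ^ m * (of_nat n * pderiv q * d + q * pderiv d)"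
    by (simp only: m pderiv_mult) (simp add: algebra_simps)
  then have "degree (q ^ n * d) = 0" by (simp add: z pderiv_eq_0_iff)
  then show False using d \<open>q \<noteq> 0\<close> q n by (simp add: degree_mult_eq degree_power_eq)
qed

definition tau :: "complex \<Rightarrow> int \<Rightarrow> complex poly" where
  "tau \<alpha> m = [:- (of_int m * \<alpha>), 1:]"

lemma pderiv_tau [simp]: "pderiv (tau \<alpha> m) = 1"
  by (simp add: tau_def pderiv_pCons one_pCons)

lemma degree_tau [simp]: "degree (tau \<alpha> m) = 1"
  by (simp add: tau_def)

text \<open>
  The commutator of two operators of the form that \<open>L\<^sub>m\<close> and \<open>L\<^sub>n\<close> will have, with \<open>A\<close>, \<open>B\<close> in the role of \<open>H\<^sub>m\<close>, \<open>H\<^sub>n\<close> and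
  \<open>U\<close>, \<open>V\<close> in that of \<open>t - m\<alpha>\<close>, \<open>t - n\<alpha>\<close>.
\<close>

lemma affine_commutator:
  fixes m n :: complex
  shows "(shift m [:smult b B, [:b:]:] * [:smult a A, [:a:]:] - const m * d_inner (shift m [:smult b B, [:b:]:]) * [:smult a U:]) -
    (shift n [:smult a A, [:a:]:] * [:smult b B, [:b:]:] - const n * d_inner (shift n [:smult a A, [:a:]:]) * [:smult b V:]) =
    [:smult (a * b) (smult n B - smult m A + smult n (V * pderiv A) - smult m (U * pderiv B)), [:a * b * (n - m):]:]"
  by (simp add: pderiv_diff pderiv_smult smult_diff_right smult_add_right algebra_simps)

text \<open>
  The polynomial \<open>h\<^sub>m\<close> lowered by \<open>m d\<close>, in terms of \<open>c = h(\<alpha>)\<close> and \<open>q = (h - c) / (t - \<alpha>)\<close>. In this form the index \<open>m\<close>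
  occurs only in the factor and in \<open>tau\<close>, so that the bracket relation is an identity for arbitrary \<open>q\<close>.
\<close>

definition Hpoly :: "complex \<Rightarrow> complex \<Rightarrow> complex poly \<Rightarrow> complex \<Rightarrow> int \<Rightarrow> complex poly" where
  "Hpoly \<alpha> c q d m = smult (of_int m) ([:c - d:] + tau \<alpha> m * q)"

lemma Hpoly_bracket:
  "smult (of_int n) (Hpoly \<alpha> c q d n) - smult (of_int m) (Hpoly \<alpha> c q d m) +
    smult (of_int n) (tau \<alpha> n * pderiv (Hpoly \<alpha> c q d m)) -
    smult (of_int m) (tau \<alpha> m * pderiv (Hpoly \<alpha> c q d n)) =
   smult (of_int (n - m)) (Hpoly \<alpha> c q d (m + n))"
proof -
  have D: "pderiv (Hpoly \<alpha> c q d m) = smult (of_int m) (q + tau \<alpha> m * pderiv q)" for m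
    by (simp add: Hpoly_def pderiv_smult pderiv_add pderiv_mult pderiv_pCons add.commute)
  show ?thesis
    unfolding D
    by (rule poly_eq_poly_eq_iff[THEN iffD1], rule ext) (simp add: Hpoly_def tau_def algebra_simps)
qed

text \<open>
  Substitute \<open>h = c + (t - \<alpha>) q\<close>; then \<open>m (t - \<alpha>) q - m (m - 1) \<alpha> q = m (t - m\<alpha>) q\<close>.
\<close>

lemma hm_eq_Hpoly:
  "hm h \<alpha> m = Hpoly \<alpha> (poly h \<alpha>) ((h - [:poly h \<alpha>:]) div [:- \<alpha>, 1:]) 0 m"
proof -
  define c where "c = poly h \<alpha>"
  define q where "q = (h - [:c:]) div [:- \<alpha>, 1:]"
  have "[:- \<alpha>, 1:] dvd h - [:c:]" by (simp add: c_def flip: poly_eq_0_iff_dvd)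
  then have "h - [:c:] = [:- \<alpha>, 1:] * q"
    unfolding q_def by (simp only: dvd_mult_div_cancel)
  then have "poly (h - [:c:]) x = poly ([:- \<alpha>, 1:] * q) x" for x by (simp only:)
  then have h: "poly h x = c + (x - \<alpha>) * poly q x" for x
    by (simp add: algebra_simps)
  show ?thesis
    unfolding hm_def c_def[symmetric] q_def[symmetric] Hpoly_def tau_def
    by (rule poly_eq_poly_eq_iff[THEN iffD1], rule ext) (simp add: h algebra_simps)
qed

text \<open>
  \<open>L\<^sub>m\<close> has the extra summand \<open>- m/2\<close> on the odd part only.
\<close>

definition odd_shift :: "bit \<Rightarrow> complex" where
  "odd_shift i = (if i = 1 then 1/2 else 0)"

lemma odd_shift_simps [simp]: "odd_shift 0 = 0" "odd_shift 1 = 1/2"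
  by (simp_all add: odd_shift_def)

section \<open>All modes of a normalised module\<close>

text \<open>
  Here \<open>v 1\<close> is scaled to be \<open>G\<^bsub>1/2\<^esub> v 0\<close>, as in the model, where \<open>G\<^bsub>-1/2\<^esub> 1 = \<lambda>\<^sup>-\<^sup>1\<close>.
\<close>

locale ns_normalised_module = ns_free_module scale hpart act v
  for scale :: "complex \<Rightarrow> 'm::ab_group_add \<Rightarrow> 'm" and hpart act v +
  fixes lam :: complex
  assumes lam_nonzero: "lam \<noteq> 0"
    and G_half_v: "opr (G 0) (v 0) = v 1"
    and G_minus_half_v: "opr (G (-1)) (v 0) = scale (1 / lam) (v 1)"
begin

lemma Gc_half_even: "Gc 0 0 = 1" "Gc (-1) 0 = const (1 / lam)"
proof -
  have "Gc 0 0 \<cdot> v 1 = 1 \<cdot> v 1" using G_basis_vector[of 0 0] G_half_v by simp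
  then show "Gc 0 0 = 1" by (simp only: ut_v_eq_iff)
  have "Gc (-1) 0 \<cdot> v 1 = const (1 / lam) \<cdot> v 1" using G_basis_vector[of "-1" 0] G_minus_half_v by simp
  then show "Gc (-1) 0 = const (1 / lam)" by (simp only: ut_v_eq_iff)
qed

text \<open>
  In the model, \<open>G\<^bsub>-1/2\<^esub>\<close> maps \<open>1\<close> in the odd part to \<open>t + \<alpha>\<close>.
\<close>

definition \<alpha> where "\<alpha> = coeff (\<gamma> (-1) 1) 0"

lemma \<gamma>_values:
  "\<gamma> 0 0 = 1" "\<gamma> (-1) 0 = [:1 / lam:]" "\<gamma> 0 1 = smult lam (tau \<alpha> 1)" "\<gamma> (-1) 1 = tau \<alpha> (-1)"
proof -
  show g: "\<gamma> 0 0 = 1" "\<gamma> (-1) 0 = [:1 / lam:]"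
    using Gc_half_even by (simp_all add: \<gamma>_def)
  have w: "w 1 0 = \<gamma> 0 1" "w (-1) 0 = smult (1 / lam) (\<gamma> (-1) 1)"
    using Gc_\<gamma>(2)[of 0 0] Gc_\<gamma>(2)[of "-1" 0] g by simp_all
  have "smult (1 / lam) (\<gamma> 0 1) + \<gamma> (-1) 1 = [:0, 2:]"
    using \<gamma>_anticommutator[of 0] g by simp
  moreover have "pderiv (smult (1 / lam) (\<gamma> 0 1) * \<gamma> (-1) 1) = [:0, 2:]"
    using w_unit_product[of 0] w by simp
  ultimately obtain c where c: "smult (1 / lam) (\<gamma> 0 1) = [:- c, 1:]" "\<gamma> (-1) 1 = [:c, 1:]"
    by (rule sum_product_linear)
  then have "c = \<alpha>" by (simp add: \<alpha>_def)
  then show "\<gamma> (-1) 1 = tau \<alpha> (-1)" using c by (simp add: tau_def)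
  have "\<gamma> 0 1 = smult lam (smult (1 / lam) (\<gamma> 0 1))" using lam_nonzero by simp
  then show "\<gamma> 0 1 = smult lam (tau \<alpha> 1)" unfolding c using \<open>c = \<alpha>\<close> by (simp add: tau_def)
qed

lemma w_eq_unit:
  assumes "e = 1 \<or> e = -1"
  shows "w e i = smult (lam powi e) (tau \<alpha> e)"
proof -
  have "w 1 i = smult lam (tau \<alpha> 1)" "w (-1) i = smult (1 / lam) (tau \<alpha> (-1))"
    using Gc_\<gamma>(2)[of 0 i] Gc_\<gamma>(2)[of "-1" i] by (cases i; simp add: \<gamma>_values)+
  then show ?thesis using assms by (auto simp: power_int_minus inverse_eq_divide)
qed

text \<open>
  The bracket with \<open>L\<^bsub>-e\<^esub>\<close> gives the Euler operator applied to \<open>w (en)\<close> in terms of \<open>w (e(n - 1))\<close>. The asserted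
  polynomial solves the same equation, and the operator is injective.
\<close>

lemma w_eq_ray:
  assumes e: "e = 1 \<or> e = -1"
  shows "w (e * int n) i = smult (lam powi (e * int n)) (tau \<alpha> (e * int n))"
proof (induction n)
  case 0
  then show ?case by (simp add: w_0 tau_def)
next
  case (Suc n)
  define N where "N = e * int (Suc n)"
  have N1: "e * (int (Suc n) - 1) = e * int n" by simp
  have Ne: "lam powi (e * int n) = lam powi (-e) * lam powi N"
    using lam_nonzero by (simp add: power_int_add[symmetric] N_def algebra_simps)
  let ?q = "w (- e) i"
  have q: "?q = smult (lam powi (-e)) (tau \<alpha> (-e))" using e by (intro w_eq_unit) auto
  have "of_int (int (Suc n)) * pderiv ?q * w N i + ?q * pderiv (w N i) =
     of_int (int (Suc n) + 1) * w (e * int n) i"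
    using w_recurrence[OF e, of "int (Suc n)" i] unfolding N1 N_def by simp
  also have "\<dots> = of_int (int (Suc n)) * pderiv ?q * smult (lam powi N) (tau \<alpha> N) +
      ?q * pderiv (smult (lam powi N) (tau \<alpha> N))"
  proof (rule poly_eq_poly_eq_iff[THEN iffD1], rule ext)
    fix x
    show "poly (of_int (int (Suc n) + 1) * w (e * int n) i) x =
      poly (of_int (int (Suc n)) * pderiv ?q * smult (lam powi N) (tau \<alpha> N) +
      ?q * pderiv (smult (lam powi N) (tau \<alpha> N))) x"
      unfolding Suc.IH q Ne
      by (simp add: pderiv_smult of_int_poly of_nat_poly)
         (simp add: tau_def N_def algebra_simps)
  qed
  finally have "of_nat (Suc n) * pderiv ?q * w N i + ?q * pderiv (w N i) =
      of_nat (Suc n) * pderiv ?q * smult (lam powi N) (tau \<alpha> N) + ?q * pderiv (smult (lam powi N) (tau \<alpha> N))"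
    by simp
  then have "w N i = smult (lam powi N) (tau \<alpha> N)"
    by (rule euler_operator_injective) (use lam_nonzero q in simp_all)
  then show ?case by (simp add: N_def)
qed

lemma int_on_ray:
  obtains e n where "e = 1 \<or> e = -1" "m = e * int n"
proof (cases "m \<ge> 0")
  case True
  then show thesis using that[of 1 "nat m"] by simp
next
  case False
  then show thesis using that[of "-1" "nat (- m)"] by simp
qed

lemma w_eq: "w m i = smult (lam powi m) (tau \<alpha> m)"
  using w_eq_ray by (metis int_on_ray)

text \<open>
  The bracket with \<open>W\<^sub>1\<close> is an equation for the difference of \<open>Lc m i\<close> under the shift by one, in which everything else is
  known.
\<close>

lemma L_affine: "\<exists>H. Lc m i = [:smult (lam powi m) H, [:lam powi m:]:]"
proof -
  have "w 1 i * [:lam powi m:] = smult (of_int m) (pderiv (w 1 i) * w m i) + smult (of_int (1 - m)) (w (m + 1) i)"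
    using lam_nonzero
    by (simp add: w_eq pderiv_smult power_int_add) (simp add: tau_def algebra_simps)
  then have "[:w 1 i:] * (Lc m i - shift 1 (Lc m i)) = [:w 1 i:] * [:[:lam powi m:]:]"
    using Lc_Wc_relation[of m 1 i] by (simp add: cocycle_def Wc_w algebra_simps)
  then have "Lc m i - shift 1 (Lc m i) = [:[:lam powi m:]:]"
    using w_nonzero[of 1 i] by (metis mult_left_cancel pCons_eq_0_iff)
  then have "shift 1 (Lc m i) = Lc m i - [:[:lam powi m:]:]" by (simp add: algebra_simps)
  then obtain b where "Lc m i = [:b, [:lam powi m:]:]" by (rule affine_of_difference)
  then have "Lc m i = [:smult (lam powi m) (smult (1 / lam powi m) b), [:lam powi m:]:]"
    using lam_nonzero by simp
  then show ?thesis by blast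
qed

definition H where "H m i = (SOME H. Lc m i = [:smult (lam powi m) H, [:lam powi m:]:])"

lemma Lc_H: "Lc m i = [:smult (lam powi m) (H m i), [:lam powi m:]:]"
  unfolding H_def by (rule someI_ex) (rule L_affine)

lemma H_0: "H 0 i = 0"
  using Lc_H[of 0 i] by (simp add: Lc_0)

text \<open>
  The constant term in \<open>s\<close> of the relation for \<open>L\<^sub>m\<close> and \<open>L\<^sub>n\<close>, divided by \<open>\<lambda>\<^bsup>m+n\<^esup>\<close>.
\<close>

lemma H_bracket:
  assumes "cocycle m n = 0"
  shows "smult (of_int n) (H n i) - smult (of_int m) (H m i) + smult (of_int n) (tau \<alpha> n * pderiv (H m i)) -
    smult (of_int m) (tau \<alpha> m * pderiv (H n i)) = smult (of_int (n - m)) (H (m + n) i)"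
    (is "?l = ?r")
proof -
  have "smult (lam powi m * lam powi n) ?l = smult (lam powi m * lam powi n) ?r"
    using Lc_Lc_relation[OF assms, of i] lam_nonzero
    unfolding Lc_H Wc_w w_eq affine_commutator by (simp add: power_int_add algebra_simps)
  then show ?thesis using lam_nonzero by (metis smult_cancel mult_eq_0_iff power_int_eq_0_iff)
qed

text \<open>
  \<open>L\<^sub>1\<close> commutes with \<open>G\<^bsub>1/2\<^esub>\<close>, which maps \<open>v 0\<close> to \<open>v 1\<close> and shifts \<open>s\<close> by \<open>1/2\<close>.
\<close>

lemma H_one_odd: "H 1 1 = H 1 0 - [:1/2:]"
proof -
  have "Lc 1 1 = shift (1/2) (Lc 1 0)"
    using L_unit_half_step[of 0 1 0] by (simp add: \<gamma>_values half_def)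
  then have "smult lam (H 1 1) = smult lam (H 1 0 - [:1/2:])"
    by (simp add: Lc_H smult_diff_right)
  then show ?thesis using lam_nonzero by (metis smult_cancel)
qed

text \<open>
  The parameter \<open>h\<close> of the model is free; it is read off from \<open>L\<^sub>1 v 0 = \<lambda> (s + h) v 0\<close>.
\<close>

definition h where "h = H 1 0"
abbreviation q where "q \<equiv> (h - [:poly h \<alpha>:]) div [:- \<alpha>, 1:]"

abbreviation H_model where "H_model i m \<equiv> Hpoly \<alpha> (poly h \<alpha>) q (odd_shift i) m"

text \<open>
  For \<open>e = 1\<close> this is the decomposition of \<open>h\<close> by its value at \<open>\<alpha>\<close>. For \<open>e = -1\<close>, the bracket of \<open>L\<^sub>1\<close> and \<open>L\<^bsub>-1\<^esub>\<close> is an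
  Euler equation for \<open>H (-1)\<close>, with \<open>q = t - \<alpha>\<close> and \<open>n = 1\<close>.
\<close>

lemma H_eq_model_unit:
  assumes e: "e = 1 \<or> e = -1"
  shows "H e i = H_model i e"
proof -
  have one: "H 1 i = H_model i 1"
  proof -
    have h: "h = H_model 0 1" using hm_eq_Hpoly[of h \<alpha> 1] by (simp add: hm_def)
    then have split: "[:poly h \<alpha>:] + tau \<alpha> 1 * q = h" by (simp add: Hpoly_def)
    have "H_model 1 1 = ([:poly h \<alpha>:] + tau \<alpha> 1 * q) - [:1/2:]" by (simp add: Hpoly_def)
    then have "H 1 1 = H_model 1 1" unfolding split H_one_odd h_def[symmetric] by (rule sym)
    then show ?thesis using h by (cases i) (simp_all add: h_def)
  qed
  moreover have "H (-1) i = H_model i (-1)"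
  proof (rule euler_operator_injective)
    \<comment> \<open>The part of the bracket relation that \<open>H (-1) i\<close> and its model have in common.\<close>
    define B where "B = H_model i 1 + tau \<alpha> (-1) * pderiv (H_model i 1)"
    have "- (H (-1) i + tau \<alpha> 1 * pderiv (H (-1) i) + B) = 0"
      using H_bracket[of 1 "-1" i] by (simp add: B_def cocycle_def H_0 one algebra_simps)
    moreover have "- (H_model i (-1) + tau \<alpha> 1 * pderiv (H_model i (-1)) + B) = 0"
      using Hpoly_bracket[of "-1" \<alpha> "poly h \<alpha>" q "odd_shift i" 1]
      by (simp add: B_def Hpoly_def[of _ _ _ _ 0] algebra_simps)
    ultimately have "H (-1) i + tau \<alpha> 1 * pderiv (H (-1) i) + B = H_model i (-1) + tau \<alpha> 1 * pderiv (H_model i (-1)) + B"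
      by (simp only: neg_equal_0_iff_equal)
    then have "H (-1) i + tau \<alpha> 1 * pderiv (H (-1) i) = H_model i (-1) + tau \<alpha> 1 * pderiv (H_model i (-1))"
      by (simp only: add_right_cancel)
    then show "of_nat 1 * pderiv (tau \<alpha> 1) * H (-1) i + tau \<alpha> 1 * pderiv (H (-1) i) =
      of_nat 1 * pderiv (tau \<alpha> 1) * H_model i (-1) + tau \<alpha> 1 * pderiv (H_model i (-1))"
      by simp
  qed simp_all
  ultimately show ?thesis using e by blast
qed

text \<open>
  As for \<open>w\<close>, by the bracket with \<open>L\<^bsub>-e\<^esub>\<close>: \<open>H\<close> and the model satisfy the same bracket relation, and all terms except those in
  \<open>H (en)\<close> agree by induction.
\<close>

lemma H_eq_model_ray:
  assumes e: "e = 1 \<or> e = -1"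
  shows "H (e * int n) i = H_model i (e * int n)"
proof (induction n)
  case 0
  then show ?case by (simp add: H_0 Hpoly_def)
next
  case (Suc n)
  define N where "N = e * int (Suc n)"
  have N1: "- e + N = e * int n" by (simp add: N_def algebra_simps)
  have u: "H (- e) i = H_model i (- e)" using e by (intro H_eq_model_unit) auto
  have co: "cocycle (- e) N = 0" unfolding N_def by (rule cocycle_sl2[OF e])
  have ee: "of_int e * of_int N = (of_nat (Suc n) :: complex)" using e by (auto simp: N_def)
  \<comment> \<open>The part of the bracket relation that \<open>H N i\<close> and its model have in common.\<close>
  define B where "B = smult (of_int e) (H_model i (- e)) + smult (of_int N) (tau \<alpha> N * pderiv (H_model i (- e)))"
  have "smult (of_int N) (H N i) + smult (of_int e) (tau \<alpha> (- e) * pderiv (H N i)) + B =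
      smult (of_int (N + e)) (H_model i (e * int n))"
    using H_bracket[OF co, of i] unfolding N1 u Suc.IH B_def by (simp add: algebra_simps)
  moreover have "smult (of_int N) (H_model i N) + smult (of_int e) (tau \<alpha> (- e) * pderiv (H_model i N)) + B =
      smult (of_int (N + e)) (H_model i (e * int n))"
    using Hpoly_bracket[of N \<alpha> "poly h \<alpha>" q "odd_shift i" "- e"] unfolding N1 B_def by (simp add: algebra_simps)
  ultimately have "smult (of_int N) (H N i) + smult (of_int e) (tau \<alpha> (- e) * pderiv (H N i)) =
     smult (of_int N) (H_model i N) + smult (of_int e) (tau \<alpha> (- e) * pderiv (H_model i N))"
    by (metis add_right_cancel)
  \<comment> \<open>Since \<open>e\<^sup>2 = 1\<close>, multiplication by \<open>e\<close> turns this into an Euler equation with \<open>n\<close> a natural number.\<close>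
  then have "smult (of_int e) (smult (of_int N) (H N i) + smult (of_int e) (tau \<alpha> (- e) * pderiv (H N i))) =
     smult (of_int e) (smult (of_int N) (H_model i N) + smult (of_int e) (tau \<alpha> (- e) * pderiv (H_model i N)))"
    by (simp only:)
  moreover have "of_int e * of_int e = (1 :: complex)" using e by auto
  ultimately have "of_nat (Suc n) * pderiv (tau \<alpha> (- e)) * H N i + tau \<alpha> (- e) * pderiv (H N i) =
     of_nat (Suc n) * pderiv (tau \<alpha> (- e)) * H_model i N + tau \<alpha> (- e) * pderiv (H_model i N)"
    unfolding smult_add_right smult_smult ee by (simp add: of_nat_poly)
  then have "H N i = H_model i N" by (rule euler_operator_injective) simp_all
  then show ?case by (simp add: N_def)
qed

lemma H_eq: "H m 0 = hm h \<alpha> m" "H m 1 = hm h \<alpha> m - [:of_int m / 2:]"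
proof -
  have "H m i = H_model i m" for i using H_eq_model_ray by (metis int_on_ray)
  then show "H m 0 = hm h \<alpha> m" "H m 1 = hm h \<alpha> m - [:of_int m / 2:]"
    unfolding hm_eq_Hpoly
    by (simp, simp, intro poly_eq_poly_eq_iff[THEN iffD1] ext) (simp add: Hpoly_def algebra_simps)
qed

lemma Lc_eq:
  "Lc m 0 = const (lam powi m) * (outer_var + [:hm h \<alpha> m:])"
  "Lc m 1 = const (lam powi m) * (outer_var - const (of_int m / 2) + [:hm h \<alpha> m:])"
proof -
  show "Lc m 0 = const (lam powi m) * (outer_var + [:hm h \<alpha> m:])"
    by (simp add: Lc_H H_eq)
  have "[:- (of_int m / 2):] + hm h \<alpha> m = hm h \<alpha> m - [:of_int m / 2:]"
    by (rule poly_eqI) (simp add: coeff_pCons split: nat.split)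
  then have "outer_var - const (of_int m / 2) + [:hm h \<alpha> m:] = [:hm h \<alpha> m - [:of_int m / 2:], 1:]"
    by simp
  then show "Lc m 1 = const (lam powi m) * (outer_var - const (of_int m / 2) + [:hm h \<alpha> m:])"
    by (simp only: Lc_H H_eq) simp
qed

lemma Wc_eq: "Wc m i = const (lam powi m) * (inner_var - const (of_int m * \<alpha>))"
  by (simp add: Wc_w w_eq tau_def)

text \<open>
  The bracket of \<open>L\<^sub>k\<close> and \<open>G\<^bsub>1/2\<^esub>\<close> is \<open>(1 - k)/2\<close> times \<open>G\<^bsub>k+1/2\<^esub>\<close>. This says nothing about \<open>G\<^bsub>3/2\<^esub>\<close>, which is obtained from
  \<open>L\<^sub>2\<close> and \<open>G\<^bsub>-1/2\<^esub>\<close> instead.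
\<close>

lemma Gc_even: "Gc k 0 = const (lam powi k)"
proof (cases "k = 1")
  case False
  have "const (half 0 - of_int k / 2) * Gc k 0 = const (half 0 - of_int k / 2) * const (lam powi k)"
    using Lc_Gc_relation[of k 0 0] by (simp add: Gc_half_even Lc_eq half_def algebra_simps)
  moreover have "const (half 0 - of_int k / 2) \<noteq> 0" using False by (auto simp: half_def)
  ultimately show ?thesis by (metis mult_left_cancel)
next
  case True
  have "const (- (3/2)) * Gc 1 0 = const (- (3/2)) * const lam"
    using Lc_Gc_relation[of 2 "-1" 0] lam_nonzero
    by (simp add: Gc_half_even Lc_eq half_def algebra_simps power2_eq_square)
  moreover have "const (- (3/2)) \<noteq> 0" by simp
  ultimately show ?thesis using True by (metis mult_left_cancel power_int_1_right)
qed

text \<open>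
  From the anticommutator of \<open>G\<^sub>r\<close> and \<open>G\<^bsub>1/2\<^esub>\<close> on \<open>v 0\<close>; the only possible central term, at \<open>r = -1/2\<close>, has the factor
  \<open>(1/2)\<^sup>2 - 1/4 = 0\<close>.
\<close>

lemma Gc_odd: "Gc k 1 = const (lam powi (k + 1)) * (inner_var - const (2 * half k * \<alpha>))"
proof -
  have "const (lam powi k) * [:smult lam (tau \<alpha> 1):] + Gc k 1 = const 2 * [:smult (lam powi (k + 1)) (tau \<alpha> (k + 1)):]"
    using Gc_Gc_relation[of 0 k 0] by (simp add: Gc_even Gc_half_even Gc_\<gamma>(1)[of 0 1] \<gamma>_values Wc_w w_eq half_def power2_eq_square pCons_one)
  then have "Gc k 1 = const 2 * [:smult (lam powi (k + 1)) (tau \<alpha> (k + 1)):] - const (lam powi k) * [:smult lam (tau \<alpha> 1):]"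
    by (simp only: eq_diff_eq add.commute)
  also have "\<dots> = const (lam powi (k + 1)) * (inner_var - const (2 * half k * \<alpha>))"
    using lam_nonzero by (simp add: power_int_add tau_def half_def algebra_simps)
  finally show ?thesis .
qed

text \<open>
  The bracket of \<open>L\<^sub>2\<close> and \<open>L\<^bsub>-2\<^esub>\<close> contains a nonzero multiple of \<open>C\<^sub>1\<close>, while the known coefficients give \<open>-4 L\<^sub>0\<close> without it.
\<close>

lemma C1_zero: "opr C1 (v i) = 0"
proof -
  have "opr (L 2) (opr (L (-2)) (v i)) - opr (L (-2)) (opr (L 2) (v i)) = const (- 4) \<cdot> opr (L 0) (v i)"
  proof -
    have "opr (L 2) (opr (L (-2)) (v i)) - opr (L (-2)) (opr (L 2) (v i)) =
       ((shift (of_int 2) (Lc (-2) i) * Lc 2 i - const (of_int 2) * d_inner (shift (of_int 2) (Lc (-2) i)) * Wc 2 i)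
     - (shift (of_int (-2)) (Lc 2 i) * Lc (-2) i - const (of_int (-2)) * d_inner (shift (of_int (-2)) (Lc 2 i)) * Wc (-2) i)) \<cdot> v i"
      by (simp only: coordinate_simps)
    also have "\<dots> = [:smult (lam powi 2 * lam powi (-2)) (smult (of_int (-2)) (H (-2) i) - smult (of_int 2) (H 2 i) +
        smult (of_int (-2)) (tau \<alpha> (-2) * pderiv (H 2 i)) - smult (of_int 2) (tau \<alpha> 2 * pderiv (H (-2) i))),
        [:lam powi 2 * lam powi (-2) * (of_int (-2) - of_int 2):]:] \<cdot> v i"
      unfolding Lc_H Wc_w w_eq affine_commutator ..
    also have "smult (of_int (-2)) (H (-2) i) - smult (of_int 2) (H 2 i) +
        smult (of_int (-2)) (tau \<alpha> (-2) * pderiv (H 2 i)) - smult (of_int 2) (tau \<alpha> 2 * pderiv (H (-2) i)) = 0"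
    proof -
      have "H m i = H_model i m" for m using H_eq_model_ray by (metis int_on_ray)
      then show ?thesis
        using Hpoly_bracket[of "-2" \<alpha> "poly h \<alpha>" q "odd_shift i" 2]
        by (simp add: Hpoly_def[of _ _ _ _ 0])
    qed
    also have "lam powi 2 * lam powi (-2) = 1" using lam_nonzero by (simp add: power_int_minus)
    also have "[:smult 1 0, [:1 * (of_int (-2) - of_int 2):]:] \<cdot> v i = const (- 4) \<cdot> opr (L 0) (v i)"
      by (simp only: L_basis_vector Lc_0 UT.scale_scale) simp
    finally show ?thesis .
  qed
  then show ?thesis using L_L_commutator[of 2 "-2" "v i"] by (simp add: cocycle_def M.scale_eq_0_iff)
qed

text \<open>
  The same for \<open>C\<^sub>2\<close>, with \<open>G\<^bsub>3/2\<^esub>\<close> and \<open>G\<^bsub>-3/2\<^esub>\<close>.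
\<close>

lemma C2_zero: "opr C2 (v i) = 0"
proof -
  have "opr (G 1) (opr (G (-2)) (v i)) + opr (G (-2)) (opr (G 1) (v i)) =
      (shift (half 1) (Gc (-2) i) * Gc 1 (opp i) + shift (half (-2)) (Gc 1 i) * Gc (-2) (opp i)) \<cdot> v i"
    by (simp only: coordinate_simps)
  also have "shift (half 1) (Gc (-2) i) * Gc 1 (opp i) + shift (half (-2)) (Gc 1 i) * Gc (-2) (opp i) = const 2 * inner_var"
    using lam_nonzero
    by (cases i) (simp_all add: Gc_even Gc_odd half_def power_int_minus power2_eq_square field_simps)
  also have "(const 2 * inner_var) \<cdot> v i = scale 2 (opr (W 0) (v i))"
    by (simp only: UT.scale_scale[symmetric] ut_const ut_inner_var)
  finally show ?thesis using G_G_anticommutator[of 1 "-2" "v i"] by (simp add: half_def power2_eq_square M.scale_eq_0_iff)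
qed

section \<open>The isomorphism with the model\<close>

definition of_omega :: "omega \<Rightarrow> 'm" where
  "of_omega x = fst x \<cdot> v 0 + snd x \<cdot> v 1"

text \<open>
  The rules for moving the generators past a polynomial have exactly the form of the action on the model, so only the
  coefficients on the basis vectors matter.
\<close>

lemma of_omega_gen: "of_omega (omega_gen lam \<alpha> h b x) = opr b (of_omega x)"
proof -
  obtain f k where x: "x = (f, k)" by force
  show ?thesis
  proof (cases b)
    case (L m)
    show ?thesis
      unfolding x L of_omega_def fst_conv snd_conv omega_gen.simps act_add L_ut L_basis_vector UT.scale_scale
        Lc_eq Wc_eq W_basis_vector UT.scale_left_diff_distrib[symmetric]
      by (intro arg_cong2[where f = "(+)"] arg_cong2[where f = UT_scale] refl ) (simp_all add: algebra_simps)
  next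
    case (W m)
    show ?thesis
      unfolding x W of_omega_def fst_conv snd_conv omega_gen.simps act_add W_ut W_basis_vector UT.scale_scale Wc_eq
      by (simp only: mult_ac)
  next
    case (G j)
    show ?thesis
      unfolding x G of_omega_def fst_conv snd_conv omega_gen.simps act_add G_ut G_basis_vector UT.scale_scale Gc_even Gc_odd opp_simps
      by (simp only: mult_ac add.commute)
  qed (simp_all add: x of_omega_def act_add C_ut C1_zero C2_zero)
qed

end

lemma vector_space_omega: "vector_space omega_scale"
  by unfold_locales
     (simp_all add: omega_scale_def prod_eq_iff smult_add_right smult_add_left[symmetric] pCons_one)

context ns_normalised_module
begin

lemma of_omega_add: "of_omega (x + y) = of_omega x + of_omega y"
  by (simp add: of_omega_def UT.scale_left_distrib algebra_simps)

lemma of_omega_scale: "of_omega (omega_scale c x) = scale c (of_omega x)"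
  unfolding of_omega_def omega_scale_def fst_conv snd_conv UT.scale_scale[symmetric] ut_const
  by (rule M.scale_right_distrib[symmetric])

lemma of_omega_act: "of_omega (omega_act lam \<alpha> h x y) = act x (of_omega y)"
proof -
  have z: "of_omega 0 = 0" by (simp add: of_omega_def)
  have s: "of_omega (sum f A) = (\<Sum>a\<in>A. of_omega (f a))" for f :: "ns_basis \<Rightarrow> omega" and A
    by (induction A rule: infinite_finite_induct) (simp_all add: of_omega_add z)
  show ?thesis
    by (simp add: omega_act_def lin_ext_def act_lin_ext[of x] s of_omega_scale of_omega_gen)
qed

lemma bij_of_omega: "bij of_omega"
proof (rule bijI)
  show "inj of_omega"
  proof (rule injI)
    fix x y assume "of_omega x = of_omega y"
    then have "(fst x - fst y) \<cdot> v 0 + (snd x - snd y) \<cdot> v 1 = 0"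
      by (simp add: of_omega_def UT.scale_left_diff_distrib algebra_simps)
    then show "x = y" using v_indep by (auto simp: prod_eq_iff dest!: v_indep)
  qed
  show "surj of_omega"
    unfolding surj_def
  proof
    fix x
    obtain f k where "x = f \<cdot> v 0 + k \<cdot> v 1" using v_span by blast
    then have "x = of_omega (f, k)" by (simp add: of_omega_def)
    then show "\<exists>y. x = of_omega y" by blast
  qed
qed

lemma of_omega_part: "of_omega ` omega_part i = hpart i"
proof
  show "of_omega ` omega_part i \<subseteq> hpart i"
    by (cases i) (auto simp: omega_part_def of_omega_def intro!: hpart_ut v_part)
  show "hpart i \<subseteq> of_omega ` omega_part i"
  proof
    fix x assume "x \<in> hpart i"
    then obtain f where f: "x = f \<cdot> v i" using hpart_coordinate by blast
    show "x \<in> of_omega ` omega_part i"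
    proof (cases i)
      case zero
      then have "x = of_omega (f, 0)" by (simp add: f of_omega_def)
      then show ?thesis using zero by (auto simp: omega_part_def)
    next
      case one
      then have "x = of_omega (0, f)" by (simp add: f of_omega_def)
      then show ?thesis using one by (auto simp: omega_part_def)
    qed
  qed
qed

lemma iso_to_omega: "supermodule_iso scale hpart act omega_scale omega_part (omega_act lam \<alpha> h)"
proof -
  define \<phi> where "\<phi> = inv of_omega"
  have \<phi>1: "\<phi> (of_omega x) = x" for x
    using bij_of_omega by (simp add: \<phi>_def bij_is_inj)
  have \<phi>2: "of_omega (\<phi> x) = x" for x
    using bij_of_omega by (simp add: \<phi>_def bij_is_surj surj_f_inv_f)
  interpret O: vector_space omega_scale by (rule vector_space_omega)
  have "Vector_Spaces.linear scale omega_scale \<phi>"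
  proof unfold_locales
    show "\<phi> (x + y) = \<phi> x + \<phi> y" for x y
      by (metis \<phi>1 \<phi>2 of_omega_add)
    show "\<phi> (scale c x) = omega_scale c (\<phi> x)" for c x
      by (metis \<phi>1 \<phi>2 of_omega_scale)
  qed
  moreover have "bij \<phi>" using bij_of_omega by (simp add: \<phi>_def bij_imp_bij_inv)
  moreover have "\<phi> ` hpart i = omega_part i" for i
    unfolding of_omega_part[symmetric] by (simp add: image_image \<phi>1)
  moreover have "\<phi> (act x y) = omega_act lam \<alpha> h x (\<phi> y)" for x y
    by (metis \<phi>1 \<phi>2 of_omega_act)
  ultimately show ?thesis unfolding supermodule_iso_def by blast
qed

end

section \<open>Finding the normalised basis\<close>

lemma parity_change_module:
  assumes "ns_module scale hpart act"
  shows "ns_module scale (parity_change hpart) act"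
proof -
  interpret ns_supermodule scale hpart act using assms by (simp add: ns_supermodule_def)
  show ?thesis
  proof unfold_locales
    show "M.subspace (parity_change hpart i)" for i
      by (simp add: parity_change_def M.subspace_part)
    show "parity_change hpart 0 \<inter> parity_change hpart 1 = {0}"
      using M.part_Int by (auto simp: parity_change_def)
    show "\<exists>a\<in>parity_change hpart 0. \<exists>b\<in>parity_change hpart 1. x = a + b" for x
      using M.part_sum[of x] by (fastforce simp: parity_change_def add.commute)
    show "act x y \<in> parity_change hpart (i + j)" if "x \<in> ns_part i" "y \<in> parity_change hpart j" for x y i j
      using act_part[of x i y "j + 1"] that unfolding parity_change_def by (simp only: add.assoc)
  qed (simp_all only: act_add_left act_scale_left act_add act_scale, rule act_bracket)
qed

text \<open>
  If both basis vectors had the same parity, the whole module would be of that parity, the odd operators would vanish, and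
  the anticommutator of \<open>G\<^bsub>1/2\<^esub>\<close> and \<open>G\<^bsub>-1/2\<^esub>\<close>, in which \<open>C\<^sub>2\<close> has coefficient zero, would show \<open>W\<^sub>0 = 0\<close>.
\<close>

lemma (in ns_supermodule) free_basis:
  assumes "UT_free_rank2 scale hpart act"
  obtains v where "ns_free_module scale hpart act v"
proof -
  obtain B where B: "B \<subseteq> hpart 0 \<union> hpart 1" "card B = 2" "\<not> UT.dependent B" "UT.span B = UNIV"
    using assms unfolding UT_free_rank2_def by blast
  obtain x y where xy: "B = {x, y}" "x \<noteq> y" using B(2) by (meson card_2_iff)
  have span: "\<exists>f k. z = f \<cdot> x + k \<cdot> y" for z
  proof -
    have "z \<in> UT.span {x, y}" using B xy by simp
    then show ?thesis
      unfolding UT.span_insert[of x] UT.span_singleton by (auto simp: algebra_simps, blast)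
  qed
  have indep: "f = 0 \<and> k = 0" if "f \<cdot> x + k \<cdot> y = 0" for f k
  proof -
    define u where "u z = (if z = x then f else k)" for z
    have sum: "(\<Sum>z\<in>{x, y}. u z \<cdot> z) = 0" using that xy by (auto simp: u_def)
    have "u x = 0" "u y = 0"
      by (rule UT.independentD[OF B(3) _ _ sum]; simp add: xy)+
    then show ?thesis using xy(2) by (simp add: u_def)
  qed
  obtain i j where x: "x \<in> hpart i" and y: "y \<in> hpart j" using B xy by auto
  have "i \<noteq> j"
  proof
    assume "i = j"
    have all: "z \<in> hpart i" for z
      using span[of z] x y \<open>i = j\<close> by (auto intro!: M.subspace_add M.subspace_part hpart_ut)
    have "z = 0" if "z \<in> hpart (i + 1)" for z
      using M.part_Int all[of z] that by (cases i) auto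
    then have G: "opr (G k) z = 0" for k z
      using act_part[OF unit_vec_part all, of "G k" z] by (simp add: add.commute)
    have "scale 2 (opr (W 0) x) = 0"
      using G_G_anticommutator[of 0 "-1" x] by (simp add: G half_def power2_eq_square)
    then have "inner_var \<cdot> x + 0 \<cdot> y = 0" by (simp add: ut_inner_var M.scale_eq_0_iff)
    from indep[OF this] show False by simp
  qed
  define v where "v k = (if k = i then x else y)" for k
  have "ns_free_module scale hpart act v"
  proof unfold_locales
    have ji: "k = j" if "k \<noteq> i" for k using that \<open>i \<noteq> j\<close> by (cases i; cases j; cases k) auto
    show "v k \<in> hpart k" for k
      using x y ji by (auto simp: v_def)
    show "\<exists>f k. z = f \<cdot> v 0 + k \<cdot> v 1" for z
      using span[of z] by (cases i) (simp_all add: v_def, metis add.commute)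
    show "f = 0 \<and> k = 0" if "f \<cdot> v 0 + k \<cdot> v 1 = 0" for f k
      using that indep[of f k] indep[of k f] by (cases i) (auto simp: v_def add.commute)
  qed
  then show thesis by (rule that)
qed

text \<open>
  The basis vector on which \<open>G\<^bsub>\<plusminus>1/2\<^esub>\<close> act by constants becomes the even one, after a parity change if it is odd; its image
  under \<open>G\<^bsub>1/2\<^esub>\<close> is the other basis vector.
\<close>

lemma (in ns_free_module) normalised_basis:
  obtains hp u lam where "hp = hpart \<or> hp = parity_change hpart" "ns_normalised_module scale hp act u lam"
proof -
  obtain i c d where c: "c \<noteq> 0" and d: "d \<noteq> 0" and G: "opr (G 0) (v i) = scale c (v (opp i))"
    "opr (G (-1)) (v i) = scale d (v (opp i))"
    by (rule odd_operators_scalar)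
  define hp where "hp = (if i = 0 then hpart else parity_change hpart)"
  define u where "u j = (if j = 0 then v i else scale c (v (opp i)))" for j :: bit
  have "ns_normalised_module scale hp act u (c / d)"
  proof (intro ns_normalised_module.intro ns_free_module.intro ns_supermodule.intro
      ns_free_module_axioms.intro ns_normalised_module_axioms.intro)
    show "ns_module scale hp act"
      using parity_change_module[OF lie_supermodule_axioms] lie_supermodule_axioms by (simp add: hp_def)
    show "u j \<in> hp j" for j
      using v_part[of 0] v_part[of 1] M.subspace_scale[OF M.subspace_part v_part]
      by (cases i; cases j) (auto simp: u_def hp_def parity_change_def)
    show "\<exists>f k. z = f \<cdot> u 0 + k \<cdot> u 1" for z
    proof -
      have "\<exists>f k. z = f \<cdot> v i + k \<cdot> v (opp i)"
        using v_span[of z] by (cases i) (simp_all, metis add.commute)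
      then obtain f k where z: "z = f \<cdot> v i + k \<cdot> v (opp i)" by blast
      have "v (opp i) = const (1 / c) \<cdot> u 1" using c by (simp add: u_def)
      then have "z = f \<cdot> u 0 + (k * const (1 / c)) \<cdot> u 1"
        unfolding z UT.scale_scale[symmetric] by (simp add: u_def)
      then show ?thesis by blast
    qed
    show "f = 0 \<and> k = 0" if "f \<cdot> u 0 + k \<cdot> u 1 = 0" for f k
    proof -
      have "f \<cdot> v i + (k * const c) \<cdot> v (opp i) = 0"
        using that unfolding UT.scale_scale[symmetric] by (simp add: u_def)
      then have "f = 0 \<and> k * const c = 0"
        using v_indep[of f "k * const c"] v_indep[of "k * const c" f] by (cases i) (auto simp: add.commute)
      then show ?thesis using c by simp
    qed
    show "c / d \<noteq> 0" using c d by simp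
    show "opr (G 0) (u 0) = u 1" by (simp add: u_def G)
    show "opr (G (-1)) (u 0) = scale (1 / (c / d)) (u 1)" using c by (simp add: u_def G)
  qed
  moreover have "hp = hpart \<or> hp = parity_change hpart" by (simp add: hp_def)
  ultimately show thesis using that by blast
qed

theorem theorem4p4:
  fixes scale :: "complex \<Rightarrow> 'm::ab_group_add \<Rightarrow> 'm"
    and hpart :: "bit \<Rightarrow> 'm set"
    and act :: "ns_alg \<Rightarrow> 'm \<Rightarrow> 'm"
  assumes "ns_module scale hpart act"
    and "UT_free_rank2 scale hpart act"
  shows "\<exists>lam \<alpha> :: complex. \<exists>h :: complex poly. lam \<noteq> 0 \<and>
           (supermodule_iso scale hpart act
              omega_scale omega_part (omega_act lam \<alpha> h) \<or>
            supermodule_iso scale (parity_change hpart) act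
              omega_scale omega_part (omega_act lam \<alpha> h))"
proof -
  have "ns_supermodule scale hpart act" using assms(1) by (simp add: ns_supermodule_def)
  then obtain v where "ns_free_module scale hpart act v"
    using assms(2) by (rule ns_supermodule.free_basis)
  then obtain hp u lam where hp: "hp = hpart \<or> hp = parity_change hpart"
    and N: "ns_normalised_module scale hp act u lam"
    by (rule ns_free_module.normalised_basis)
  interpret N: ns_normalised_module scale hp act u lam by (rule N)
  show ?thesis using hp N.iso_to_omega N.lam_nonzero by blast
qed

end
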